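(* Let $H\le F_m$ be a non-cyclic free factor such that the core $\Delta_H$ has more than one vertex, and let $\varphi$ be the Whitehead automorphism given by Ascari's theorem (recalled in the context), so that $\Delta_{\varphi(H)}$ has strictly fewer vertices and strictly fewer edges than $\Delta_H$ and can be obtained from $\Delta_H$ by collapsing certain edges of $\Delta_H$. Then the ergodic automaton $\mathcal{B}_{\varphi(H)}$ that recognizes $L_{\varphi(H)}$ can be obtained from $\mathcal{B}_H$ by collapsing certain edges of $\mathcal{B}_H$.
   Context: Free group and words. $F_m$ is the free group of finite rank $m>2$ with fixed basis $X=\{x_1,\dots,x_m\}$, and $\Sigma=X\cup X^{-1}$. A word $y_1\cdots y_n$ over $\Sigma$ is reduced if $y_{i+1}\ne y_i^{-1}$ for all $i$, and cyclically reduced if moreover $y_n\ne y_1^{-1}$. Standing assumption: $H$ is a non-trivial, non-cyclic finitely generated subgroup generated by cyclically reduced words. For a subgroup $K\le F_m$, $L_K$ is the language of reduced words representing elements of $K$. Core. For a finitely generated $K\le F_m$, the Schreier graph has the right cosets $Kg$ as vertices and, for each coset and each $x\in X$, an edge labeled $x$ from $Kg$ to $Kgx$; its root is $v_1=K$. The core $\Delta_K$ is the subgraph that is the union of the reduced closed paths based at $v_1$ (edges may be traversed backwards, reading the inverse letter). The extended core $\widehat\Delta_K$ has the same vertices and, for each edge $e$ of $\Delta_K$ labeled $x$, both $e$ and an inverse edge $\bar e$ labeled $x^{-1}$ from the terminus of $e$ to its origin. If an edge of $\widehat\Delta_K$ labeled $z$ has origin $v$, its terminus is denoted $vz$. Automaton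 $\mathcal{B}_K$. Its states are the pairs $(v,y)$, with $v$ a vertex of $\widehat\Delta_K$ and $y\in\Sigma$, such that some edge of $\widehat\Delta_K$ labeled $y$ terminates at $v$. From $(v,y)$ there is an edge labeled $z$ to $(vz,z)$ whenever $\widehat\Delta_K$ has an edge labeled $z$ with origin $v$ and $z\ne y^{-1}$. Both the initial and the final states are all states of the form $(v_1,y)$. A word is accepted if it labels a path from an initial to a final state; the automaton recognizes the set of accepted words. An automaton is ergodic if its transition diagram is strongly connected. Collapsing in an automaton. Collapsing the edges that terminate at a state $\sigma$ means that every two-edge path $p\to\sigma\to r$, whose second edge is labeled $z$, becomes a single edge $p\to r$ labeled $z$, and the state $\sigma$ disappears (if $\sigma$ was an initial and final state, it is replaced in that role by the origins $p$ of the collapsed edges). Whitehead automorphism. For $a\in\Sigma$ and $A\subseteq\Sigma\setminus\{a,a^{-1}\}$, $\varphi=(A,a)$ is the automorphism of $F_m$ with $a\mapsto a$ and, for the other generators, $x_j\mapsto x_j$ if $x_j,x_j^{-1}\notin A$; $x_j\mapsto ax_j$ if $x_j\in A$, $x_j^{-1}\notin A$; $x_j\mapsto x_ja^{-1}$ if $x_j\notin A$, $x_j^{-1}\in A$; $x_j\mapsto ax_ja^{-1}$ if $x_j,x_j^{-1}\in A$. Ascari's theorem. Let $H\le F_m$ be a free factor and suppose $\Delta_H$ has more than one vertex. Then there is a Whitehead automorphism $\varphi$ such that $\Delta_{\varphi(H)}$ has strictly fewer vertices and strictly fewer edges than $\Delta_H$. Additionally, $\varphi$ can be chosen in such a way that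 $\Delta_{\varphi(H)}$ can be obtained from $\Delta_H$ by collapsing certain edges of $\Delta_H$. *)

theory Defs
  imports "HOL-Algebra.Algebra" "HOL-Library.Cardinality"
begin

text \<open>
  The basis is the universe of a finite type \<open>'x\<close>, so the rank is \<open>CARD('x)\<close>. The letter
  \<open>(x, True)\<close> stands for \<open>x\<close> and \<open>(x, False)\<close> for its inverse. Elements of the free
  group are the reduced words.
\<close>

type_synonym 'x letter = "'x \<times> bool"
type_synonym 'x word = "'x letter list"

definition inv_letter :: "'x letter \<Rightarrow> 'x letter" where
  "inv_letter y = (fst y, \<not> snd y)"

definition inv_word :: "'x word \<Rightarrow> 'x word" where
  "inv_word w = rev (map inv_letter w)"

definition reduced :: "'x word \<Rightarrow> bool" where
  "reduced w \<longleftrightarrow> successively (\<lambda>y z. z \<noteq> inv_letter y) w"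

definition cyclically_reduced :: "'x word \<Rightarrow> bool" where
  "cyclically_reduced w \<longleftrightarrow> reduced w \<and> (w \<noteq> [] \<longrightarrow> last w \<noteq> inv_letter (hd w))"

fun cancel :: "'x letter \<Rightarrow> 'x word \<Rightarrow> 'x word" where
  "cancel y [] = [y]"
| "cancel y (z # w) = (if z = inv_letter y then w else y # z # w)"

definition reduce :: "'x word \<Rightarrow> 'x word" where
  "reduce w = foldr cancel w []"

definition free_group :: "'x word monoid" where
  "free_group = \<lparr>carrier = {w. reduced w}, monoid.mult = (\<lambda>u v. reduce (u @ v)), one = []\<rparr>"

lemma inv_letter_invol [simp]: "inv_letter (inv_letter y) = y"
  by (simp add: inv_letter_def)

lemma inv_letter_eq_iff: "inv_letter y = z \<longleftrightarrow> y = inv_letter z"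
  by (metis inv_letter_invol)

lemma reduced_Nil [simp]: "reduced []"
  by (simp add: reduced_def)

lemma reduced_Cons: "reduced (y # w) \<longleftrightarrow> (w = [] \<or> hd w \<noteq> inv_letter y) \<and> reduced w"
  by (cases w) (auto simp: reduced_def)

lemma reduced_cancel: "reduced w \<Longrightarrow> reduced (cancel y w)"
  by (cases w) (auto simp: reduced_Cons)

lemma reduced_foldr_cancel: "reduced v \<Longrightarrow> reduced (foldr cancel u v)"
  by (induction u) (auto simp: reduced_cancel)

lemma reduced_reduce [simp]: "reduced (reduce w)"
  by (simp add: reduce_def reduced_foldr_cancel)

lemma reduce_reduced [simp]: "reduced w \<Longrightarrow> reduce w = w"
proof (induction w)
  case (Cons y w)
  then have "reduce w = w" by (simp add: reduced_Cons)
  then have "reduce (y # w) = cancel y w" by (simp add: reduce_def)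
  also have "\<dots> = y # w" using Cons.prems by (cases w) (auto simp: reduced_Cons)
  finally show ?case .
qed (simp add: reduce_def)

lemma cancel_inv: "reduced w \<Longrightarrow> cancel y (cancel (inv_letter y) w) = w"
proof (cases w)
  case (Cons z w')
  moreover assume "reduced w"
  ultimately show ?thesis
    by (cases w') (auto simp: reduced_Cons)
qed simp

lemma foldr_cancel_cancel:
  "reduced v \<Longrightarrow> foldr cancel (cancel y u) v = cancel y (foldr cancel u v)"
  by (cases u) (auto simp: cancel_inv reduced_foldr_cancel)

lemma foldr_cancel_reduce:
  "reduced v \<Longrightarrow> foldr cancel (reduce u) v = foldr cancel u v"
proof (induction u)
  case (Cons y u)
  have "reduce (y # u) = cancel y (reduce u)" by (simp add: reduce_def)
  then show ?case using Cons by (simp add: foldr_cancel_cancel)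
qed (simp add: reduce_def)

lemma reduce_append_left [simp]: "reduce (reduce u @ v) = reduce (u @ v)"
proof -
  have "foldr cancel (reduce u) (reduce v) = foldr cancel u (reduce v)"
    by (rule foldr_cancel_reduce) simp
  then show ?thesis by (simp add: reduce_def)
qed

lemma reduce_append_right [simp]: "reduce (u @ reduce v) = reduce (u @ v)"
proof -
  have "foldr cancel (reduce v) [] = reduce v"
    using reduce_reduced[of "reduce v"] by (simp add: reduce_def[of "reduce v"])
  then have "reduce (u @ reduce v) = foldr cancel u (reduce v)"
    by (simp add: reduce_def[of "u @ reduce v"])
  then show ?thesis by (simp add: reduce_def)
qed

lemma reduce_inv_left: "reduce (inv_word w @ w) = []"
proof (induction w)
  case (Cons y w)
  have "cancel (inv_letter y) (cancel y (reduce w)) = reduce w"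
    using cancel_inv[of "reduce w" "inv_letter y"] by simp
  then have "reduce ([inv_letter y] @ y # w) = reduce w"
    by (simp add: reduce_def)
  then have "reduce (inv_word w @ [inv_letter y] @ y # w) = reduce (inv_word w @ w)"
    by (metis reduce_append_right)
  then show ?case using Cons by (simp add: inv_word_def)
qed (simp add: inv_word_def)

lemma group_free_group: "group free_group"
proof (rule groupI)
  fix u :: "'x word" assume "u \<in> carrier free_group"
  show "\<exists>v\<in>carrier free_group. v \<otimes>\<^bsub>free_group\<^esub> u = \<one>\<^bsub>free_group\<^esub>"
    by (rule bexI[of _ "reduce (inv_word u)"]) (simp_all add: free_group_def reduce_inv_left)
qed (simp_all add: free_group_def)

text \<open>
  \<open>G\<close> is the internal free product of \<open>H\<close> and \<open>K\<close>: the two subgroups generate \<open>G\<close> and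
  no non-empty product of non-trivial elements taken alternately from \<open>H\<close> and \<open>K\<close> is trivial.
  The products of length two give \<open>H \<inter> K = {\<one>}\<close>.
\<close>

definition internal_free_product :: "('a, 'b) monoid_scheme \<Rightarrow> 'a set \<Rightarrow> 'a set \<Rightarrow> bool" where
  "internal_free_product G H K \<longleftrightarrow>
     subgroup H G \<and> subgroup K G \<and> generate G (H \<union> K) = carrier G \<and>
     (\<forall>gs. gs \<noteq> [] \<longrightarrow> set gs \<subseteq> (H \<union> K) - {\<one>\<^bsub>G\<^esub>} \<longrightarrow>
           successively (\<lambda>g h. g \<in> H \<and> h \<in> K \<or> g \<in> K \<and> h \<in> H) gs \<longrightarrow>
           foldr (\<otimes>\<^bsub>G\<^esub>) gs \<one>\<^bsub>G\<^esub> \<noteq> \<one>\<^bsub>G\<^esub>)"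

definition free_factor :: "('a, 'b) monoid_scheme \<Rightarrow> 'a set \<Rightarrow> bool" where
  "free_factor G H \<longleftrightarrow> (\<exists>K. internal_free_product G H K)"

text \<open>The endomorphism of the free group that sends each basis element \<open>x\<close> to \<open>f x\<close>.\<close>

definition free_hom :: "('x \<Rightarrow> 'x word) \<Rightarrow> 'x word \<Rightarrow> 'x word" where
  "free_hom f w = reduce (concat (map (\<lambda>(x, s). if s then f x else inv_word (f x)) w))"

definition whitehead_gen :: "'x letter set \<Rightarrow> 'x letter \<Rightarrow> 'x \<Rightarrow> 'x word" where
  "whitehead_gen A a x =
    (if x = fst a then [(x, True)]
     else if (x, True) \<in> A \<and> (x, False) \<notin> A then [a, (x, True)]
     else if (x, True) \<notin> A \<and> (x, False) \<in> A then [(x, True), inv_letter a]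
     else if (x, True) \<in> A \<and> (x, False) \<in> A then [a, (x, True), inv_letter a]
     else [(x, True)])"

definition whitehead_automorphism :: "('x word \<Rightarrow> 'x word) \<Rightarrow> bool" where
  "whitehead_automorphism \<phi> \<longleftrightarrow>
     (\<exists>A a. A \<subseteq> UNIV - {a, inv_letter a} \<and> \<phi> = free_hom (whitehead_gen A a))"

text \<open>An edge is a triple (origin, label, terminus).\<close>

record ('v, 'l) rooted_graph =
  verts :: "'v set"
  edges :: "('v \<times> 'l \<times> 'v) set"
  root :: 'v

fun is_path :: "('v \<times> 'l \<times> 'v) set \<Rightarrow> 'v \<Rightarrow> ('v \<times> 'l \<times> 'v) list \<Rightarrow> 'v \<Rightarrow> bool" where
  "is_path E u [] v \<longleftrightarrow> u = v"
| "is_path E u ((u', y, w) # p) v \<longleftrightarrow> u' = u \<and> (u, y, w) \<in> E \<and> is_path E w p v"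

definition path_label :: "('v \<times> 'l \<times> 'v) list \<Rightarrow> 'l list" where
  "path_label p = map (\<lambda>(u, y, v). y) p"

definition extended_edges :: "('v, 'x) rooted_graph \<Rightarrow> ('v \<times> 'x letter \<times> 'v) set" where
  "extended_edges \<Gamma> = {(u, (x, True), v) | u x v. (u, x, v) \<in> edges \<Gamma>} \<union>
                      {(v, (x, False), u) | u x v. (u, x, v) \<in> edges \<Gamma>}"

definition inv_edge :: "'v \<times> 'x letter \<times> 'v \<Rightarrow> 'v \<times> 'x letter \<times> 'v" where
  "inv_edge = (\<lambda>(u, y, v). (v, inv_letter y, u))"

definition reduced_closed_path ::
    "('v, 'x) rooted_graph \<Rightarrow> ('v \<times> 'x letter \<times> 'v) list \<Rightarrow> bool" where
  "reduced_closed_path \<Gamma> p \<longleftrightarrow>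
     is_path (extended_edges \<Gamma>) (root \<Gamma>) p (root \<Gamma>) \<and> successively (\<lambda>e f. f \<noteq> inv_edge e) p"

definition schreier_graph :: "'x word set \<Rightarrow> ('x word set, 'x) rooted_graph" where
  "schreier_graph K =
     \<lparr>verts = rcosets\<^bsub>free_group\<^esub> K,
      edges = {(V, x, V #>\<^bsub>free_group\<^esub> [(x, True)]) | V x. V \<in> rcosets\<^bsub>free_group\<^esub> K},
      root = K\<rparr>"

definition core_edges :: "'x word set \<Rightarrow> ('x word set \<times> 'x \<times> 'x word set) set" where
  "core_edges K =
     {(u, x, v). (u, x, v) \<in> edges (schreier_graph K) \<and>
        (\<exists>p. reduced_closed_path (schreier_graph K) p \<and>
             ((u, (x, True), v) \<in> set p \<or> (v, (x, False), u) \<in> set p))}"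

text \<open>The root is always a vertex, by the closed path of length zero.\<close>

definition core :: "'x word set \<Rightarrow> ('x word set, 'x) rooted_graph" where
  "core K =
     \<lparr>verts = {K} \<union> {u. \<exists>x v. (u, x, v) \<in> core_edges K \<or> (v, x, u) \<in> core_edges K},
      edges = core_edges K,
      root = K\<rparr>"

text \<open>
  \<open>graph_collapse \<Gamma> \<Gamma>'\<close>: up to an isomorphism of rooted labeled graphs, \<open>\<Gamma>'\<close> arises from
  \<open>\<Gamma>\<close> by collapsing the edges in some set \<open>S\<close>. The map \<open>f\<close> identifies exactly the vertices
  joined by paths in \<open>S\<close>. The remaining edges keep their labels; as edges are triples here,
  bijectivity is what keeps distinct edges from being folded together.
\<close>

definition graph_collapse :: "('v, 'x) rooted_graph \<Rightarrow> ('w, 'x) rooted_graph \<Rightarrow> bool" where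
  "graph_collapse \<Gamma> \<Gamma>' \<longleftrightarrow>
     (\<exists>S f. S \<subseteq> edges \<Gamma> \<and>
        f ` verts \<Gamma> = verts \<Gamma>' \<and> f (root \<Gamma>) = root \<Gamma>' \<and>
        (let R = {(u, v). \<exists>x. (u, x, v) \<in> S} in
           \<forall>u\<in>verts \<Gamma>. \<forall>v\<in>verts \<Gamma>. f u = f v \<longleftrightarrow> (u, v) \<in> (R \<union> R\<inverse>)\<^sup>*) \<and>
        bij_betw (\<lambda>(u, x, v). (f u, x, f v)) (edges \<Gamma> - S) (edges \<Gamma>'))"

record ('q, 'l) automaton =
  states :: "'q set"
  transitions :: "('q \<times> 'l \<times> 'q) set"
  initials :: "'q set"
  finals :: "'q set"

definition accepted_words :: "('q, 'l) automaton \<Rightarrow> 'l list set" where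
  "accepted_words M =
     {path_label p | p q r. q \<in> initials M \<and> r \<in> finals M \<and> is_path (transitions M) q p r}"

definition ergodic :: "('q, 'l) automaton \<Rightarrow> bool" where
  "ergodic M \<longleftrightarrow> (\<forall>q\<in>states M. \<forall>r\<in>states M. \<exists>p. is_path (transitions M) q p r)"

definition automaton_iso :: "('q, 'l) automaton \<Rightarrow> ('r, 'l) automaton \<Rightarrow> bool" where
  "automaton_iso M N \<longleftrightarrow>
     (\<exists>h. bij_betw h (states M) (states N) \<and>
        (\<lambda>(p, z, q). (h p, z, h q)) ` transitions M = transitions N \<and>
        h ` initials M = initials N \<and> h ` finals M = finals N)"

text \<open>
  Collapsing the edges that terminate at \<open>\<sigma>\<close>. A loop at \<open>\<sigma>\<close> would be turned into an edge
  ending in the removed state, so \<open>collapse_step\<close> excludes loops.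
\<close>

definition predecessors :: "('q, 'l) automaton \<Rightarrow> 'q \<Rightarrow> 'q set" where
  "predecessors M \<sigma> = {p. \<exists>y. (p, y, \<sigma>) \<in> transitions M}"

definition replace_state :: "'q \<Rightarrow> 'q set \<Rightarrow> 'q set \<Rightarrow> 'q set" where
  "replace_state \<sigma> P I = (if \<sigma> \<in> I then (I - {\<sigma>}) \<union> P else I)"

definition collapse_state :: "'q \<Rightarrow> ('q, 'l) automaton \<Rightarrow> ('q, 'l) automaton" where
  "collapse_state \<sigma> M =
     \<lparr>states = states M - {\<sigma>},
      transitions =
        {(p, z, r). (p, z, r) \<in> transitions M \<and> p \<noteq> \<sigma> \<and> r \<noteq> \<sigma>} \<union>
        {(p, z, r). p \<in> predecessors M \<sigma> \<and> (\<sigma>, z, r) \<in> transitions M},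
      initials = replace_state \<sigma> (predecessors M \<sigma>) (initials M),
      finals = replace_state \<sigma> (predecessors M \<sigma>) (finals M)\<rparr>"

definition collapse_step :: "('q, 'l) automaton \<Rightarrow> ('q, 'l) automaton \<Rightarrow> bool" where
  "collapse_step M M' \<longleftrightarrow>
     (\<exists>\<sigma>\<in>states M. \<sigma> \<notin> predecessors M \<sigma> \<and> M' = collapse_state \<sigma> M)"

definition automaton_collapse :: "('q, 'l) automaton \<Rightarrow> ('r, 'l) automaton \<Rightarrow> bool" where
  "automaton_collapse M N \<longleftrightarrow> (\<exists>M'. collapse_step\<^sup>*\<^sup>* M M' \<and> automaton_iso M' N)"

definition B_states :: "'x word set \<Rightarrow> ('x word set \<times> 'x letter) set" where
  "B_states K = {(v, y). v \<in> verts (core K) \<and> (\<exists>u. (u, y, v) \<in> extended_edges (core K))}"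

definition B_automaton :: "'x word set \<Rightarrow> ('x word set \<times> 'x letter, 'x letter) automaton" where
  "B_automaton K =
     \<lparr>states = B_states K,
      transitions = {((v, y), z, (w, z)) | v y z w.
         (v, y) \<in> B_states K \<and> (v, z, w) \<in> extended_edges (core K) \<and> z \<noteq> inv_letter y},
      initials = {(v, y) \<in> B_states K. v = root (core K)},
      finals = {(v, y) \<in> B_states K. v = root (core K)}\<rparr>"

definition reduced_language :: "'x word set \<Rightarrow> 'x word set" where
  "reduced_language K = {w. reduced w \<and> reduce w \<in> K}"

end

theory Submission
  imports Defs
begin

text \<open>
  States of the automaton of \<open>K\<close> correspond to oriented edges of the core, and its paths to
  reduced walks. Collapsing the states given by a set \<open>S\<close> of edges leaves a transition from \<open>e\<close>
  to \<open>e'\<close> exactly when some reduced walk through \<open>S\<close> joins them. If \<open>S\<close> is a forest, this walk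
  is unique, no loops arise, and the result is the automaton of the contracted core.

  That \<open>S\<close> is a forest follows from \<open>\<phi>\<close> being injective: contraction induces a surjection
  \<open>\<psi>\<close> from \<open>H\<close> to \<open>\<phi>(H)\<close>, and \<open>\<phi>\<inverse>\<psi>\<close> is a surjective endomorphism of the finitely generated
  group \<open>H\<close>, whose kernel is killed by every homomorphism from \<open>H\<close> to the group of order two. A
  cycle in \<open>S\<close> would give an element of the kernel that crosses some edge an odd number of times.

  The automaton of \<open>H\<close> is ergodic because \<open>H\<close> is not cyclic, and collapsing preserves this.
  Ergodicity of the automaton of \<open>\<phi>(H)\<close> in turn forces its root to have degree at least two, which
  makes every reduced word of \<open>\<phi>(H)\<close> readable from some initial state.
\<close>

section \<open>Words and the free group\<close>

declare split_paired_Ex [simp del] split_paired_All [simp del]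

lemma inv_letter_neq [simp]: "inv_letter y \<noteq> y" "y \<noteq> inv_letter y"
  by (auto simp: inv_letter_def prod_eq_iff)

lemma inv_letter_inject [simp]: "inv_letter y = inv_letter z \<longleftrightarrow> y = z"
  by (metis inv_letter_invol)

lemma inv_word_Nil [simp]: "inv_word [] = []"
  by (simp add: inv_word_def)

lemma inv_word_Cons: "inv_word (y # w) = inv_word w @ [inv_letter y]"
  by (simp add: inv_word_def)

lemma inv_word_append [simp]: "inv_word (u @ v) = inv_word v @ inv_word u"
  by (simp add: inv_word_def)

lemma inv_word_invol [simp]: "inv_word (inv_word w) = w"
  by (simp add: inv_word_def rev_map[symmetric] comp_def)

lemma inv_word_eq_Nil [simp]: "inv_word w = [] \<longleftrightarrow> w = []"
  by (simp add: inv_word_def)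

lemma hd_inv_word: "w \<noteq> [] \<Longrightarrow> hd (inv_word w) = inv_letter (last w)"
  by (simp add: inv_word_def hd_rev last_map)

lemma last_inv_word: "w \<noteq> [] \<Longrightarrow> last (inv_word w) = inv_letter (hd w)"
  by (simp add: inv_word_def last_rev hd_map)

lemma reduced_append:
  "reduced (u @ v) \<longleftrightarrow>
     reduced u \<and> reduced v \<and> (u = [] \<or> v = [] \<or> hd v \<noteq> inv_letter (last u))"
  by (simp add: reduced_def successively_append_iff)

lemma reduced_singleton [simp]: "reduced [y]"
  by (simp add: reduced_def)

lemma reduced_inv_word [simp]: "reduced (inv_word w) \<longleftrightarrow> reduced w"
proof -
  have "successively (\<lambda>x y. x \<noteq> inv_letter y) w = successively (\<lambda>y z. z \<noteq> inv_letter y) w"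
    by (rule successively_cong) (auto simp: inv_letter_eq_iff)
  then show ?thesis
    by (simp add: reduced_def inv_word_def successively_map)
qed

lemma reduce_Cons: "reduce (y # w) = cancel y (reduce w)"
  by (simp add: reduce_def)

lemma reduce_Nil [simp]: "reduce [] = []"
  by (simp add: reduce_def)

lemma reduce_append_middle: "reduce (u @ reduce v @ w) = reduce (u @ v @ w)"
  by (metis reduce_append_left reduce_append_right)

lemma reduce_inv_right: "reduce (w @ inv_word w) = []"
  using reduce_inv_left[of "inv_word w"] by simp

lemma carrier_free_group [simp]: "carrier free_group = {w. reduced w}"
  by (simp add: free_group_def)

lemma mult_free_group [simp]: "u \<otimes>\<^bsub>free_group\<^esub> v = reduce (u @ v)"
  by (simp add: free_group_def)

lemma one_free_group [simp]: "\<one>\<^bsub>free_group\<^esub> = []"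
  by (simp add: free_group_def)

lemma m_inv_free_group [simp]: "reduced w \<Longrightarrow> inv\<^bsub>free_group\<^esub> w = inv_word w"
  by (rule group.inv_equality[OF group_free_group]) (simp_all add: reduce_inv_left)

lemma subgroup_free_groupD:
  assumes "subgroup K free_group"
  shows "[] \<in> K" "u \<in> K \<Longrightarrow> reduced u" "u \<in> K \<Longrightarrow> inv_word u \<in> K"
    "u \<in> K \<Longrightarrow> v \<in> K \<Longrightarrow> reduce (u @ v) \<in> K"
proof -
  show red: "reduced u" if "u \<in> K" for u
    using subgroup.subset[OF assms] that by auto
  show "[] \<in> K" using subgroup.one_closed[OF assms] by simp
  show "inv_word u \<in> K" if "u \<in> K"
    using subgroup.m_inv_closed[OF assms that] red[OF that] by simp
  show "reduce (u @ v) \<in> K" if "u \<in> K" "v \<in> K"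
    using subgroup.m_closed[OF assms that] by simp
qed

section \<open>Homomorphisms\<close>

text \<open>Replaces the pattern-matching lambda of \<open>free_hom\<close> by a function on letters
  that visibly commutes with inversion.\<close>

definition letter_image :: "('x \<Rightarrow> 'x word) \<Rightarrow> 'x letter \<Rightarrow> 'x word" where
  "letter_image f y = (if snd y then f (fst y) else inv_word (f (fst y)))"

lemma free_hom_eq: "free_hom f w = reduce (concat (map (letter_image f) w))"
proof -
  have "(\<lambda>(x, s). if s then f x else inv_word (f x)) = letter_image f"
    by (auto simp: letter_image_def fun_eq_iff)
  then show ?thesis by (simp add: free_hom_def)
qed

lemma letter_image_inv [simp]: "letter_image f (inv_letter y) = inv_word (letter_image f y)"
  by (simp add: letter_image_def inv_letter_def)

text \<open>Cancelling two adjacent letters of \<open>w\<close> removes two mutually inverse words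
  from the image, so the reduced image does not change. This makes \<open>free_hom f\<close>
  multiplicative.\<close>

lemma reduce_concat_letter_image_reduce:
  "reduce (concat (map (letter_image f) (reduce w))) = reduce (concat (map (letter_image f) w))"
proof (induction w)
  case (Cons y w)
  have "reduce (concat (map (letter_image f) (cancel y u))) =
        reduce (letter_image f y @ concat (map (letter_image f) u))" for u
  proof (cases u)
    case (Cons z v)
    have "reduce (letter_image f y @ inv_word (letter_image f y) @ v') = reduce v'" for v'
      using reduce_append_left[of "letter_image f y @ inv_word (letter_image f y)" v']
      by (simp add: reduce_inv_right)
    then show ?thesis using Cons by simp
  qed simp
  then have "reduce (concat (map (letter_image f) (reduce (y # w)))) =
        reduce (letter_image f y @ reduce (concat (map (letter_image f) (reduce w))))"
    by (simp add: reduce_Cons)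
  also have "\<dots> = reduce (letter_image f y @ concat (map (letter_image f) w))"
    using Cons by simp
  finally show ?case by simp
qed simp

lemma free_hom_hom: "free_hom f \<in> hom free_group free_group"
  by (rule homI) (simp_all add: free_hom_eq reduce_concat_letter_image_reduce)

text \<open>Both substitutions fix the letter \<open>a\<close>, and the second inserts its inverse
  wherever the first inserts \<open>a\<close>, so the inserted letters cancel.\<close>

lemma letter_image_whitehead_gen_inverse:
  assumes "A \<subseteq> UNIV - {a, inv_letter a}"
  shows "reduce (concat (map (letter_image (whitehead_gen A (inv_letter a)))
           (letter_image (whitehead_gen A a) y))) = [y]"
proof -
  obtain x s where y: "y = (x, s)" by (cases y)
  obtain b t where a: "a = (b, t)" by (cases a)
  show ?thesis
    unfolding y a
    by (cases s; cases t)
      (auto simp: letter_image_def whitehead_gen_def inv_letter_def inv_word_def reduce_def)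
qed

lemma whitehead_automorphism_inj:
  assumes "whitehead_automorphism \<phi>"
  shows "\<phi> \<in> hom free_group free_group" "inj_on \<phi> (carrier free_group)"
proof -
  obtain A a where A: "A \<subseteq> UNIV - {a, inv_letter a}" and \<phi>: "\<phi> = free_hom (whitehead_gen A a)"
    using assms unfolding whitehead_automorphism_def by blast
  show "\<phi> \<in> hom free_group free_group" unfolding \<phi> by (rule free_hom_hom)
  let ?g = "letter_image (whitehead_gen A a)" and ?g' = "letter_image (whitehead_gen A (inv_letter a))"
  have "reduce (concat (map ?g' (concat (map ?g w)))) = reduce w" for w
  proof (induction w)
    case (Cons y w)
    have "reduce (concat (map ?g' (concat (map ?g (y # w))))) =
      reduce (reduce (concat (map ?g' (?g y))) @ reduce (concat (map ?g' (concat (map ?g w)))))"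
      by simp
    also have "\<dots> = reduce ([y] @ reduce w)"
      using letter_image_whitehead_gen_inverse[OF A, of y] Cons by simp
    finally show ?case using reduce_append_right[of "[y]" w] by simp
  qed simp
  then have "free_hom (whitehead_gen A (inv_letter a)) (\<phi> w) = w" if "reduced w" for w
    using that by (simp add: \<phi> free_hom_eq reduce_concat_letter_image_reduce)
  then show "inj_on \<phi> (carrier free_group)"
    by (intro inj_on_inverseI[where g = "free_hom (whitehead_gen A (inv_letter a))"]) simp
qed

section \<open>Walking through cosets\<close>

definition move :: "'x word set \<Rightarrow> 'x letter \<Rightarrow> 'x word set" where
  "move V y = V #>\<^bsub>free_group\<^esub> [y]"

fun walk :: "'x word set \<Rightarrow> 'x word \<Rightarrow> 'x word set" where
  "walk V [] = V"
| "walk V (y # w) = walk (move V y) w"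

text \<open>Serves both for walks inside the core (\<open>core_step\<close>) and for walks inside
  the contracted edges (\<open>collapsed\<close>).\<close>

fun stays :: "('x word set \<Rightarrow> 'x letter \<Rightarrow> bool) \<Rightarrow> 'x word set \<Rightarrow> 'x word \<Rightarrow> bool" where
  "stays P V [] \<longleftrightarrow> True"
| "stays P V (y # w) \<longleftrightarrow> P V y \<and> stays P (move V y) w"

lemma walk_append [simp]: "walk V (u @ v) = walk (walk V u) v"
  by (induction u arbitrary: V) auto

lemma stays_append [simp]: "stays P V (u @ v) \<longleftrightarrow> stays P V u \<and> stays P (walk V u) v"
  by (induction u arbitrary: V) auto

lemma move_eq: "move V y = (\<lambda>v. reduce (v @ [y])) ` V"
  by (auto simp: move_def r_coset_def)

lemma move_subset: "move V y \<subseteq> Collect reduced"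
  by (auto simp: move_eq)

text \<open>Reducedness of \<open>V\<close> matters at the empty word, where the walk leaves
  \<open>V\<close> as it is while the right-hand side reduces its elements.\<close>

lemma walk_eq:
  assumes "V \<subseteq> Collect reduced"
  shows "walk V w = (\<lambda>v. reduce (v @ w)) ` V"
  using assms
proof (induction w arbitrary: V)
  case Nil
  have "reduce v = v" if "v \<in> V" for v using Nil that by auto
  then show ?case by force
next
  case (Cons y w)
  have "walk V (y # w) = (\<lambda>v. reduce (reduce (v @ [y]) @ w)) ` V"
    using Cons.IH[OF move_subset[of V y]] by (simp add: move_eq image_image)
  then show ?case by simp
qed

lemma walk_subset:
  assumes "V \<subseteq> Collect reduced"
  shows "walk V w \<subseteq> Collect reduced"
  by (auto simp: walk_eq[OF assms])

lemma walk_reduce: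
  assumes "V \<subseteq> Collect reduced"
  shows "walk V (reduce w) = walk V w"
  by (simp add: walk_eq[OF assms])

lemma move_inv:
  assumes "V \<subseteq> Collect reduced"
  shows "move (move V y) (inv_letter y) = V"
proof -
  have "walk V [y, inv_letter y] = walk V []"
    using walk_reduce[OF assms, of "[y, inv_letter y]"] by (simp add: reduce_def)
  then show ?thesis by simp
qed

lemma walk_inv_word:
  assumes "V \<subseteq> Collect reduced"
  shows "walk (walk V w) (inv_word w) = V"
proof -
  have "walk V (w @ inv_word w) = walk V []"
    using walk_reduce[OF assms, of "w @ inv_word w"] by (simp add: reduce_inv_right)
  then show ?thesis by simp
qed

text \<open>Translates between closed walks at the root and membership in \<open>K\<close>.\<close>

lemma walk_subgroup_eq_iff:
  assumes K: "subgroup K free_group"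
  shows "walk K w = K \<longleftrightarrow> reduce w \<in> K"
proof
  note sub = subgroup.subset[OF K, simplified]
  interpret group free_group by (rule group_free_group)
  have eq: "walk K w = K #>\<^bsub>free_group\<^esub> reduce w"
    by (auto simp: walk_eq[OF sub] r_coset_def)
  show "reduce w \<in> K" if "walk K w = K"
    using coset_join1[of K "reduce w"] that K eq by simp
  show "walk K w = K" if "reduce w \<in> K"
    using coset_join2[of "reduce w" K] that K eq by simp
qed

text \<open>After a letter and its inverse the walk is back where it was, so the reduced word only
  takes steps that the original word takes.\<close>

lemma stays_reduce:
  assumes "V \<subseteq> Collect reduced" "stays P V w"
  shows "stays P V (reduce w)"
  using assms
proof (induction w arbitrary: V)
  case (Cons y w)
  then have *: "stays P (move V y) (reduce w)" by (simp add: move_subset)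
  show ?case
  proof (cases "reduce w")
    case Nil
    then show ?thesis using Cons.prems by (simp add: reduce_Cons)
  next
    case (Cons z u)
    then show ?thesis using * Cons.prems move_inv[of V y] \<open>stays P V (y # w)\<close>
      by (auto simp: reduce_Cons)
  qed
qed simp

section \<open>The core and its automaton\<close>

text \<open>A description of the core without paths: elements of \<open>K\<close> are exactly the
  labels of reduced closed paths at the root, so these are the letters of the extended core edges
  leaving \<open>V\<close> (\<open>extended_edges_core\<close>).\<close>

definition core_step :: "'x word set \<Rightarrow> 'x word set \<Rightarrow> 'x letter \<Rightarrow> bool" where
  "core_step K V y \<longleftrightarrow> (\<exists>a b. a @ y # b \<in> K \<and> V = walk K a)"

text \<open>For a subgroup these are the labels of the core edges leaving the root
  (\<open>core_step_root_iff\<close>); their number is the degree of the root.\<close>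

definition heads :: "'x word set \<Rightarrow> 'x letter set" where
  "heads K = hd ` (K - {[]})"

fun walk_edges :: "'x word set \<Rightarrow> 'x word \<Rightarrow> ('x word set \<times> 'x letter \<times> 'x word set) list" where
  "walk_edges V [] = []"
| "walk_edges V (y # w) = (V, y, move V y) # walk_edges (move V y) w"

lemma path_label_Nil [simp]: "path_label [] = []"
  by (simp add: path_label_def)

lemma path_label_Cons [simp]: "path_label ((u, y, v) # p) = y # path_label p"
  by (simp add: path_label_def)

lemma path_label_walk_edges [simp]: "path_label (walk_edges V w) = w"
  by (induction w arbitrary: V) auto

lemma in_set_walk_edges_iff:
  "(u, y, v) \<in> set (walk_edges V w) \<longleftrightarrow>
     (\<exists>a b. w = a @ y # b \<and> u = walk V a \<and> v = move u y)"
proof (induction w arbitrary: V)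
  case (Cons z w)
  have "(\<exists>a b. z # w = a @ y # b \<and> u = walk V a \<and> v = move u y) \<longleftrightarrow>
    (z = y \<and> u = V \<and> v = move u y) \<or>
    (\<exists>a b. w = a @ y # b \<and> u = walk (move V z) a \<and> v = move u y)"
    (is "?l \<longleftrightarrow> ?r")
  proof
    assume ?l
    then obtain a b where *: "z # w = a @ y # b" "u = walk V a" "v = move u y" by blast
    then show ?r by (cases a) auto
  next
    assume ?r
    then show ?l
    proof
      assume "z = y \<and> u = V \<and> v = move u y"
      then show ?l by (intro exI[of _ "[]"] exI[of _ w]) simp
    next
      assume "\<exists>a b. w = a @ y # b \<and> u = walk (move V z) a \<and> v = move u y"
      then obtain a b where "w = a @ y # b" "u = walk (move V z) a" "v = move u y" by blast
      then show ?l by (intro exI[of _ "z # a"] exI[of _ b]) simp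
    qed
  qed
  then show ?case using Cons by auto
qed simp

text \<open>A step is determined by its origin and its letter, so turning back along an edge is the
  same as reading the inverse letter next.\<close>

lemma successively_walk_edges:
  assumes "V \<subseteq> Collect reduced"
  shows "successively (\<lambda>e f. f \<noteq> inv_edge e) (walk_edges V w) \<longleftrightarrow> reduced w"
  using assms
proof (induction w arbitrary: V)
  case (Cons y w)
  then show ?case using move_inv[of V y]
    by (cases w) (auto simp: successively_Cons reduced_Cons move_subset inv_edge_def)
qed simp

context
  fixes K :: "'x word set"
  assumes K: "subgroup K free_group"
begin

lemma subgroup_subset_reduced: "K \<subseteq> Collect reduced"
  using subgroup.subset[OF K] by simp

lemma rcosets_free_group: "rcosets\<^bsub>free_group\<^esub> K = range (walk K)"
proof -
  have *: "K #>\<^bsub>free_group\<^esub> w = walk K w" for w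
    by (auto simp: walk_eq[OF subgroup_subset_reduced] r_coset_def)
  have "walk K w \<in> (\<Union>a\<in>carrier free_group. {walk K a})" for w
    using walk_reduce[OF subgroup_subset_reduced, of w] by (intro UN_I[of "reduce w"]) simp_all
  then show ?thesis
    unfolding RCOSETS_def * by blast
qed

lemma rcoset_subset_reduced: "V \<in> rcosets\<^bsub>free_group\<^esub> K \<Longrightarrow> V \<subseteq> Collect reduced"
  using walk_subset[OF subgroup_subset_reduced] by (auto simp: rcosets_free_group)

lemma rcoset_move: "V \<in> rcosets\<^bsub>free_group\<^esub> K \<Longrightarrow> move V y \<in> rcosets\<^bsub>free_group\<^esub> K"
proof -
  assume "V \<in> rcosets\<^bsub>free_group\<^esub> K"
  then obtain w where "V = walk K w" unfolding rcosets_free_group by blast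
  then have "move V y = walk K (w @ [y])" by simp
  then show ?thesis unfolding rcosets_free_group by blast
qed

lemma extended_edges_schreier_graph:
  "extended_edges (schreier_graph K) = {(V, y, move V y) | V y. V \<in> rcosets\<^bsub>free_group\<^esub> K}"
proof -
  have inv: "inv_letter (x, True) = (x, False)" "inv_letter (x, False) = (x, True)" for x :: 'x
    by (simp_all add: inv_letter_def)
  have "(V, (x, True), W) \<in> extended_edges (schreier_graph K) \<longleftrightarrow>
    V \<in> rcosets\<^bsub>free_group\<^esub> K \<and> W = move V (x, True)" for V x W
    by (auto simp: extended_edges_def schreier_graph_def move_def)
  moreover have "(V, (x, False), W) \<in> extended_edges (schreier_graph K) \<longleftrightarrow>
    V \<in> rcosets\<^bsub>free_group\<^esub> K \<and> W = move V (x, False)" (is "?l \<longleftrightarrow> ?r") for V x W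
  proof -
    have "?l \<longleftrightarrow> W \<in> rcosets\<^bsub>free_group\<^esub> K \<and> V = move W (x, True)"
      by (auto simp: extended_edges_def schreier_graph_def move_def)
    also have "\<dots> \<longleftrightarrow> ?r"
      using move_inv[OF rcoset_subset_reduced, of V "(x, False)"] rcoset_move[of V "(x, False)"]
        move_inv[OF rcoset_subset_reduced, of W "(x, True)"] rcoset_move[of W "(x, True)"]
      unfolding inv by blast
    finally show ?thesis .
  qed
  ultimately have "(V, y, W) \<in> extended_edges (schreier_graph K) \<longleftrightarrow>
    V \<in> rcosets\<^bsub>free_group\<^esub> K \<and> W = move V y" for V y W
    by (cases y; cases "snd y") auto
  then show ?thesis by auto
qed

lemma is_path_schreier_graph:
  assumes "V \<in> rcosets\<^bsub>free_group\<^esub> K"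
  shows "is_path (extended_edges (schreier_graph K)) V p W \<longleftrightarrow>
    p = walk_edges V (path_label p) \<and> W = walk V (path_label p)"
  using assms
proof (induction p arbitrary: V)
  case (Cons e p)
  obtain u y v where "e = (u, y, v)" by (cases e)
  then show ?case
    using Cons.IH[OF rcoset_move[OF Cons.prems, of y]] Cons.prems
    by (auto simp: extended_edges_schreier_graph)
qed auto

lemma root_in_rcosets: "K \<in> rcosets\<^bsub>free_group\<^esub> K"
proof -
  have "K = walk K []" by simp
  then show ?thesis unfolding rcosets_free_group by blast
qed

lemma core_step_rcoset: "core_step K V y \<Longrightarrow> V \<in> rcosets\<^bsub>free_group\<^esub> K"
  by (auto simp: core_step_def rcosets_free_group)

lemma walk_mem: "w \<in> K \<Longrightarrow> walk K w = K"
  using walk_subgroup_eq_iff[OF K] subgroup_free_groupD(2)[OF K] by simp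

text \<open>The inverse of an element of \<open>K\<close> traverses the same edge in the opposite
  direction.\<close>

lemma core_step_inv:
  assumes "core_step K V y"
  shows "core_step K (move V y) (inv_letter y)"
proof -
  obtain a b where w: "a @ y # b \<in> K" and V: "V = walk K a"
    using assms unfolding core_step_def by blast
  have "inv_word b @ inv_letter y # inv_word a \<in> K"
    using subgroup_free_groupD(3)[OF K w] by (simp add: inv_word_Cons)
  moreover have "move V y = walk K (inv_word b)"
    using walk_mem[OF w] walk_inv_word[OF move_subset, of V y b] V by simp
  ultimately show ?thesis unfolding core_step_def by blast
qed

lemma core_step_inv_iff:
  assumes "V \<subseteq> Collect reduced"
  shows "core_step K (move V y) (inv_letter y) \<longleftrightarrow> core_step K V y"
proof
  assume "core_step K (move V y) (inv_letter y)"
  then have "core_step K (move (move V y) (inv_letter y)) (inv_letter (inv_letter y))"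
    by (rule core_step_inv)
  then show "core_step K V y" by (simp add: move_inv[OF assms])
qed (rule core_step_inv)

text \<open>A path is determined by its origin and label; absence of backtracking makes the label
  reduced, and closedness puts it into \<open>K\<close>.\<close>

lemma reduced_closed_path_schreier_graph:
  "reduced_closed_path (schreier_graph K) p \<longleftrightarrow> (\<exists>w\<in>K. p = walk_edges K w)"
proof -
  have root: "root (schreier_graph K) = K" by (simp add: schreier_graph_def)
  have mem: "reduced w \<and> walk K w = K \<longleftrightarrow> w \<in> K" for w
    unfolding walk_subgroup_eq_iff[OF K] using subgroup_free_groupD(2)[OF K] by (metis reduce_reduced)
  have "reduced_closed_path (schreier_graph K) p \<longleftrightarrow>
    (\<exists>w. p = walk_edges K w \<and> reduced w \<and> walk K w = K)"
    unfolding reduced_closed_path_def root is_path_schreier_graph[OF root_in_rcosets]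
    using successively_walk_edges[OF subgroup_subset_reduced] by (metis path_label_walk_edges)
  then show ?thesis unfolding mem by blast
qed

lemma core_edges_iff:
  "(u, x, v) \<in> core_edges K \<longleftrightarrow> core_step K u (x, True) \<and> v = move u (x, True)"
proof -
  have inv: "inv_letter (x, False) = (x, True)" by (simp add: inv_letter_def)
  have "(u, x, v) \<in> edges (schreier_graph K) \<longleftrightarrow> u \<in> rcosets\<^bsub>free_group\<^esub> K \<and> v = move u (x, True)"
    by (auto simp: schreier_graph_def move_def)
  moreover have "(\<exists>p. (\<exists>w\<in>K. p = walk_edges K w) \<and> (u, y, v) \<in> set p) \<longleftrightarrow>
    core_step K u y \<and> v = move u y" for u y v
  proof -
    have "(\<exists>p. (\<exists>w\<in>K. p = walk_edges K w) \<and> (u, y, v) \<in> set p) \<longleftrightarrow>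
      (\<exists>w\<in>K. (u, y, v) \<in> set (walk_edges K w))" by blast
    then show ?thesis unfolding in_set_walk_edges_iff core_step_def by blast
  qed
  ultimately have "(u, x, v) \<in> core_edges K \<longleftrightarrow>
    u \<in> rcosets\<^bsub>free_group\<^esub> K \<and> v = move u (x, True) \<and>
    (core_step K u (x, True) \<and> v = move u (x, True) \<or> core_step K v (x, False) \<and> u = move v (x, False))"
    unfolding core_edges_def reduced_closed_path_schreier_graph
    by (simp add: conj_disj_distribL ex_disj_distrib)
  moreover have "core_step K u (x, True)" if "core_step K v (x, False)" "u = move v (x, False)"
    using core_step_inv[OF that(1)] unfolding that(2)[symmetric] inv .
  ultimately show ?thesis
    using core_step_rcoset[of u "(x, True)"] by argo
qed

lemma extended_edges_core:
  "(V, y, W) \<in> extended_edges (core K) \<longleftrightarrow> core_step K V y \<and> W = move V y"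
proof -
  obtain x s where y: "y = (x, s)" by (cases y)
  have inv: "inv_letter (x, True) = (x, False)" "inv_letter (x, False) = (x, True)"
    by (simp_all add: inv_letter_def)
  have "(V, (x, False), W) \<in> extended_edges (core K) \<longleftrightarrow> core_step K V (x, False) \<and> W = move V (x, False)"
    (is "?l \<longleftrightarrow> ?r")
  proof -
    have "?l \<longleftrightarrow> core_step K W (x, True) \<and> V = move W (x, True)"
      by (auto simp: extended_edges_def core_def core_edges_iff)
    also have "\<dots> \<longleftrightarrow> ?r"
      using core_step_inv[of V "(x, False)"] core_step_inv[of W "(x, True)"]
        move_inv[OF rcoset_subset_reduced[OF core_step_rcoset], of V "(x, False)" "(x, False)"]
        move_inv[OF rcoset_subset_reduced[OF core_step_rcoset], of W "(x, True)" "(x, True)"]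
      unfolding inv by blast
    finally show ?thesis .
  qed
  moreover have "(V, (x, True), W) \<in> extended_edges (core K) \<longleftrightarrow> core_step K V (x, True) \<and> W = move V (x, True)"
    by (auto simp: extended_edges_def core_def core_edges_iff)
  ultimately show ?thesis unfolding y by (cases s) auto
qed

lemma verts_core: "verts (core K) = insert K {V. \<exists>y. core_step K V y}"
proof -
  have "V \<in> verts (core K) \<longleftrightarrow>
    V = K \<or> (\<exists>x W. (V, (x, True), W) \<in> extended_edges (core K) \<or> (V, (x, False), W) \<in> extended_edges (core K))" for V
    by (auto simp: core_def extended_edges_def)
  also have "\<dots> V \<longleftrightarrow> V = K \<or> (\<exists>y. core_step K V y)" for V
    unfolding extended_edges_core by (metis (full_types) surj_pair)
  finally show ?thesis by blast
qed

text \<open>A state is an oriented core edge ending in \<open>V\<close>. Testing the reversed edge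
  instead avoids a quantifier over origins.\<close>

lemma B_states_iff: "(V, y) \<in> B_states K \<longleftrightarrow> core_step K V (inv_letter y)"
proof -
  have "core_step K V (inv_letter y)" if "core_step K U y" "V = move U y" for U
    using core_step_inv that by blast
  moreover have "\<exists>U. core_step K U y \<and> V = move U y" if "core_step K V (inv_letter y)"
    using core_step_inv[OF that] move_inv[OF rcoset_subset_reduced[OF core_step_rcoset[OF that]]]
    by (metis inv_letter_invol)
  ultimately show ?thesis
    unfolding B_states_def case_prod_conv mem_Collect_eq extended_edges_core verts_core by blast
qed

lemma B_transitions_iff:
  "((V, y), z, (W, z')) \<in> transitions (B_automaton K) \<longleftrightarrow>
     core_step K V (inv_letter y) \<and> core_step K V z \<and> z \<noteq> inv_letter y \<and> W = move V z \<and> z' = z"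
  by (auto simp: B_automaton_def extended_edges_core B_states_iff)

lemma B_simps [simp]:
  "states (B_automaton K) = B_states K"
  "initials (B_automaton K) = {(v, y) \<in> B_states K. v = K}"
  "finals (B_automaton K) = {(v, y) \<in> B_states K. v = K}"
  by (simp_all add: B_automaton_def core_def)

text \<open>The letter stored in a state only forbids its inverse as the next letter. Hence paths
  from \<open>(V, y)\<close> are reduced continuations of \<open>y\<close> inside the core, and the
  word determines the end state.\<close>

lemma is_path_B_automaton:
  assumes "(V, y) \<in> B_states K"
  shows "(\<exists>p. is_path (transitions (B_automaton K)) (V, y) p r \<and> path_label p = w) \<longleftrightarrow>
    reduced (y # w) \<and> stays (core_step K) V w \<and> r = (walk V w, last (y # w))"
  using assms
proof (induction w arbitrary: V y)
  case Nil
  have "path_label p = [] \<longleftrightarrow> p = []" for p :: "(('x word set \<times> 'x letter) \<times> 'x letter \<times> ('x word set \<times> 'x letter)) list"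
    by (simp add: path_label_def)
  then show ?case by (auto simp: reduced_Cons)
next
  case (Cons z w)
  let ?T = "transitions (B_automaton K)"
  have "(\<exists>p. is_path ?T (V, y) p r \<and> path_label p = z # w) \<longleftrightarrow>
    (\<exists>s. ((V, y), z, s) \<in> ?T \<and> (\<exists>p. is_path ?T s p r \<and> path_label p = w))" (is "?l \<longleftrightarrow> ?r")
  proof
    assume ?l
    then obtain p where p: "is_path ?T (V, y) p r" "path_label p = z # w" by blast
    then obtain e p' where "p = e # p'" by (cases p) auto
    with p show ?r by (cases e) auto
  next
    assume ?r
    then obtain s p where "((V, y), z, s) \<in> ?T" "is_path ?T s p r" "path_label p = w" by blast
    then have "is_path ?T (V, y) (((V, y), z, s) # p) r \<and> path_label (((V, y), z, s) # p) = z # w"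
      by simp
    then show ?l by blast
  qed
  also have "\<dots> \<longleftrightarrow> core_step K V z \<and> z \<noteq> inv_letter y \<and>
      (\<exists>p. is_path ?T (move V z, z) p r \<and> path_label p = w)"
    using Cons.prems
    by (auto simp: B_transitions_iff B_states_iff intro!: exI[of _ "(move V z, z)"])
  also have "\<dots> \<longleftrightarrow> core_step K V z \<and> z \<noteq> inv_letter y \<and> reduced (z # w) \<and>
      stays (core_step K) (move V z) w \<and> r = (walk (move V z) w, last (z # w))"
    using Cons.IH[of "move V z" z] by (auto simp: B_states_iff core_step_inv)
  finally show ?case by (auto simp: reduced_Cons[of y])
qed

lemma stays_core_step_factor:
  assumes "a @ w @ b \<in> K"
  shows "stays (core_step K) (walk K a) w"
  using assms
proof (induction w arbitrary: a)
  case (Cons y w)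
  then show ?case using Cons.IH[of "a @ [y]"] by (auto simp: core_step_def)
qed simp

lemma stays_member: "w \<in> K \<Longrightarrow> stays (core_step K) K w"
  using stays_core_step_factor[of "[]" w "[]"] by simp

lemma heads_iff: "l \<in> heads K \<longleftrightarrow> (\<exists>w. l # w \<in> K)"
proof
  assume "l \<in> heads K"
  then obtain w where "w \<in> K" "w \<noteq> []" "l = hd w" unfolding heads_def by blast
  then have "l # tl w \<in> K" by simp
  then show "\<exists>w. l # w \<in> K" ..
next
  assume "\<exists>w. l # w \<in> K"
  then obtain w where "l # w \<in> K" ..
  then have "l # w \<in> K - {[]}" "l = hd (l # w)" by simp_all
  then show "l \<in> heads K" unfolding heads_def by blast
qed

lemma hd_in_heads: "w \<in> K \<Longrightarrow> w \<noteq> [] \<Longrightarrow> hd w \<in> heads K"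
  unfolding heads_def by auto

lemma inv_last_in_heads: "w \<in> K \<Longrightarrow> w \<noteq> [] \<Longrightarrow> inv_letter (last w) \<in> heads K"
  using hd_in_heads[of "inv_word w"] subgroup_free_groupD(3)[OF K] by (simp add: hd_inv_word)

text \<open>If an element of \<open>K\<close> reads \<open>l\<close> while at the root, the prefix
  before \<open>l\<close> lies in \<open>K\<close> itself and can be divided off.\<close>

lemma core_step_root_iff: "core_step K K l \<longleftrightarrow> l \<in> heads K"
proof
  assume "core_step K K l"
  then obtain a b where ab: "a @ l # b \<in> K" and a: "walk K a = K"
    unfolding core_step_def by auto
  have red: "reduced (a @ l # b)" using subgroup_free_groupD(2)[OF K ab] .
  then have "a \<in> K" using a walk_subgroup_eq_iff[OF K, of a] by (simp add: reduced_append)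
  then have "reduce (inv_word a @ a @ l # b) \<in> K"
    using subgroup_free_groupD(3,4)[OF K] ab by blast
  moreover have "reduce (inv_word a @ a @ l # b) = l # b"
    using reduce_append_left[of "inv_word a @ a" "l # b"] red
    by (simp add: reduce_inv_left reduced_append)
  ultimately show "l \<in> heads K" unfolding heads_iff by auto
next
  assume "l \<in> heads K"
  then obtain w where "[] @ l # w \<in> K" unfolding heads_iff by auto
  then show "core_step K K l" unfolding core_step_def by (metis walk.simps(1))
qed

text \<open>A start state blocks one head as first letter. With two heads, every element of
  \<open>K\<close> finds a start state that does not block its first letter.\<close>

lemma accepted_words_B_automaton:
  assumes two: "\<exists>l\<in>heads K. \<exists>l'\<in>heads K. l \<noteq> l'"
  shows "accepted_words (B_automaton K) = reduced_language K"
proof -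
  have state: "(K, y) \<in> B_states K \<longleftrightarrow> inv_letter y \<in> heads K" for y
    by (simp add: B_states_iff core_step_root_iff)
  have "w \<in> accepted_words (B_automaton K) \<longleftrightarrow>
    (\<exists>y z. (K, y) \<in> B_states K \<and> (K, z) \<in> B_states K \<and>
      (\<exists>p. is_path (transitions (B_automaton K)) (K, y) p (K, z) \<and> path_label p = w))" for w
    unfolding accepted_words_def by fastforce
  also have "\<dots> w \<longleftrightarrow> (\<exists>y z. (K, y) \<in> B_states K \<and> (K, z) \<in> B_states K \<and>
      reduced (y # w) \<and> stays (core_step K) K w \<and> (K, z) = (walk K w, last (y # w)))" for w
    by (simp add: is_path_B_automaton cong: conj_cong)
  also have "\<dots> w \<longleftrightarrow> (\<exists>y. inv_letter y \<in> heads K \<and> inv_letter (last (y # w)) \<in> heads K \<and>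
      reduced (y # w) \<and> stays (core_step K) K w \<and> walk K w = K)" for w
    unfolding state by auto
  also have "\<dots> w \<longleftrightarrow> w \<in> K" for w
  proof
    assume "w \<in> K"
    \<comment> \<open>The start state is \<open>(K, inv_letter l)\<close>, which blocks only
      \<open>l\<close>. For the empty word it is also the final state.\<close>
    obtain l where l: "l \<in> heads K" "w \<noteq> [] \<Longrightarrow> hd w \<noteq> l" using two by metis
    have "inv_letter (inv_letter l) \<in> heads K" using l by simp
    moreover have "inv_letter (last (inv_letter l # w)) \<in> heads K"
      using l inv_last_in_heads[OF \<open>w \<in> K\<close>] by auto
    moreover have "reduced (inv_letter l # w)"
      using l subgroup_free_groupD(2)[OF K \<open>w \<in> K\<close>] by (auto simp: reduced_Cons)
    moreover have "stays (core_step K) K w"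
      using stays_member[OF \<open>w \<in> K\<close>] .
    ultimately show "\<exists>y. inv_letter y \<in> heads K \<and> inv_letter (last (y # w)) \<in> heads K \<and>
      reduced (y # w) \<and> stays (core_step K) K w \<and> walk K w = K"
      using walk_mem[OF \<open>w \<in> K\<close>] by blast
  next
    assume "\<exists>y. inv_letter y \<in> heads K \<and> inv_letter (last (y # w)) \<in> heads K \<and>
      reduced (y # w) \<and> stays (core_step K) K w \<and> walk K w = K"
    then have "reduced w" "reduce w \<in> K"
      unfolding walk_subgroup_eq_iff[OF K] reduced_Cons by blast+
    then show "w \<in> K" by simp
  qed
  finally have "w \<in> accepted_words (B_automaton K) \<longleftrightarrow> w \<in> K" for w .
  then show ?thesis
    using subgroup_free_groupD(2)[OF K] by (auto simp: reduced_language_def)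
qed

text \<open>Take a path from the reverse of an edge leaving the root to that edge itself. It is not
  empty, since the two states carry different letters, and its first step leaves the root by another
  edge.\<close>

lemma two_heads_if_ergodic:
  assumes "ergodic (B_automaton K)" "K \<noteq> {[]}"
  shows "\<exists>l\<in>heads K. \<exists>l'\<in>heads K. l \<noteq> l'"
proof -
  have "[] \<in> K" using subgroup_free_groupD(1)[OF K] .
  then obtain k where "k \<in> K" "k \<noteq> []" using assms(2) by blast
  then have l: "hd k \<in> heads K" (is "?l \<in> _") by (rule hd_in_heads)
  have step: "core_step K K ?l" using l by (simp add: core_step_root_iff)
  have "(K, inv_letter ?l) \<in> B_states K" using step by (simp add: B_states_iff)
  moreover have "(move K ?l, ?l) \<in> B_states K" using core_step_inv[OF step] by (simp add: B_states_iff)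
  ultimately obtain p where
    "is_path (transitions (B_automaton K)) (K, inv_letter ?l) p (move K ?l, ?l)"
    using assms(1) unfolding ergodic_def by auto
  then have *: "reduced (inv_letter ?l # path_label p)" "stays (core_step K) K (path_label p)"
    "?l = last (inv_letter ?l # path_label p)"
    using is_path_B_automaton[OF \<open>(K, inv_letter ?l) \<in> B_states K\<close>] by blast+
  then obtain z w where w: "path_label p = z # w" by (cases "path_label p") auto
  then have "z \<noteq> ?l" "z \<in> heads K" using * by (auto simp: reduced_Cons core_step_root_iff)
  then show ?thesis using l by blast
qed

end

section \<open>Ergodicity\<close>

context
  fixes K :: "'x word set"
  assumes K: "subgroup K free_group"
begin

lemma mult_inv_common_suffix:
  assumes "u @ c \<in> K" "v @ c \<in> K"
  shows "reduce (u @ inv_word v) \<in> K"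
proof -
  have "reduce ((u @ c) @ inv_word (v @ c)) \<in> K"
    using subgroup_free_groupD[OF K] assms by blast
  moreover have "reduce ((u @ c) @ inv_word (v @ c)) = reduce (u @ inv_word v)"
    using reduce_append_middle[of u "c @ inv_word c" "inv_word v"] by (simp add: reduce_inv_right)
  ultimately show ?thesis by simp
qed

text \<open>Once the longest common suffix is cancelled, the quotient of two elements is already
  reduced, so its first and last letters can be read off.\<close>

lemma reduced_append_inv_word:
  assumes "u @ c \<in> K" "v @ c \<in> K" "u = [] \<or> v = [] \<or> last u \<noteq> last v"
  shows "reduced (u @ inv_word v)"
  using assms subgroup_free_groupD(2)[OF K assms(1)] subgroup_free_groupD(2)[OF K assms(2)]
  by (auto simp: reduced_append hd_inv_word)

text \<open>Otherwise a shortest element of \<open>K\<close> whose first letter is not \<open>s\<close> generates \<open>K\<close>.\<close>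

lemma exists_element_avoiding_letters:
  assumes noncyclic: "\<And>g. g \<in> K \<Longrightarrow> K \<noteq> generate free_group {g}"
    and s: "s \<in> heads K" and t: "t \<in> heads K" and r: "r \<in> heads K" "r \<noteq> s"
  shows "\<exists>k\<in>K. k \<noteq> [] \<and> hd k \<noteq> s \<and> last k \<noteq> inv_letter t"
proof (rule ccontr)
  assume "\<not> ?thesis"
  then have last: "last k = inv_letter t" if "k \<in> K" "k \<noteq> []" "hd k \<noteq> s" for k
    using that by blast
  note red = subgroup_free_groupD(2)[OF K]
  \<comment> \<open>Otherwise multiply an element starting with \<open>t\<close> by one starting
    with \<open>s\<close>: the product is reduced and starts with \<open>t\<close>, so the second
    factor ends with the inverse of \<open>t\<close>. The inverse of that factor starts with
    \<open>t\<close>, yet it ends with the inverse of \<open>s\<close>.\<close>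
  have "t = s"
  proof (rule ccontr)
    assume "t \<noteq> s"
    obtain g h where g: "t # g \<in> K" and h: "s # h \<in> K" using s t heads_iff[OF K] by metis
    have "last (t # g) = inv_letter t" using last[OF g] \<open>t \<noteq> s\<close> by simp
    then have "reduced ((t # g) @ s # h)"
      using red[OF g] red[OF h] \<open>t \<noteq> s\<close> by (simp only: reduced_append) simp
    moreover have "reduce ((t # g) @ s # h) \<in> K" using subgroup_free_groupD(4)[OF K g h] .
    ultimately have "(t # g) @ s # h \<in> K" by simp
    then have "last ((t # g) @ s # h) = inv_letter t" using last[of "(t # g) @ s # h"] \<open>t \<noteq> s\<close> by simp
    then have "last (s # h) = inv_letter t" by simp
    then have "hd (inv_word (s # h)) = t" by (subst hd_inv_word) simp_all
    then have "last (inv_word (s # h)) = inv_letter t"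
      using last[of "inv_word (s # h)"] subgroup_free_groupD(3)[OF K h] \<open>t \<noteq> s\<close> by simp
    moreover have "last (inv_word (s # h)) = inv_letter s" by (subst last_inv_word) simp_all
    ultimately show False using \<open>t \<noteq> s\<close> by simp
  qed
  \<comment> \<open>By \<open>last\<close> and \<open>t = s\<close>, every element of
    \<open>A\<close> ends with the inverse of \<open>s\<close>. A shortest one is the candidate for
    a generator.\<close>
  define A where "A = {k \<in> K. k \<noteq> [] \<and> hd k \<noteq> s}"
  obtain g0 where "r # g0 \<in> K" using r(1) heads_iff[OF K] by blast
  then have "r # g0 \<in> A" using r(2) unfolding A_def by simp
  then obtain g where g: "g \<in> A" and min: "\<And>h. h \<in> A \<Longrightarrow> length g \<le> length h"
    using ex_has_least_nat[of "\<lambda>k. k \<in> A" "r # g0" length] by blast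
  then have gK: "g \<in> K" "g \<noteq> []" "hd g \<noteq> s" unfolding A_def by auto
  define G where "G = generate free_group {g}"
  have subG: "subgroup G free_group"
    unfolding G_def using red[OF gK(1)] by (intro group.generate_is_subgroup[OF group_free_group]) simp
  note G = subgroup_free_groupD[OF subG]
  have gG: "g \<in> G" unfolding G_def by (simp add: generate.incl)
  have A_G: "h \<in> G" if "h \<in> A" for h
    using that
  proof (induction h rule: length_induct)
    case (1 h)
    then have h: "h \<in> K" "h \<noteq> []" "hd h \<noteq> s" unfolding A_def by auto
    obtain c u v where c: "h = u @ c" "g = v @ c" "u = [] \<or> v = [] \<or> last u \<noteq> last v"
      using longest_common_suffix[of h g] by blast
    have "reduced (u @ inv_word v)"
      using reduced_append_inv_word[of u c v] h(1) gK(1) c by simp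
    then have uv: "u @ inv_word v \<in> K"
      using mult_inv_common_suffix[of u c v] h(1) gK(1) c by simp
    \<comment> \<open>In the first case minimality of \<open>g\<close> forces \<open>h = g\<close>;
      in the second, \<open>h\<close> is a shorter element of \<open>A\<close> followed by
      \<open>g\<close>; in the third, \<open>u @ inv_word v\<close> lies in \<open>A\<close>, so
      \<open>g\<close> would start with \<open>t\<close>, which is \<open>s\<close>.\<close>
    consider "u = []" | "u \<noteq> []" "v = []" | "u \<noteq> []" "v \<noteq> []" by blast
    then show ?case
    proof cases
      case 1
      then have "length g \<le> length c" using min[OF \<open>h \<in> A\<close>] c by simp
      then show ?thesis using gG c 1 by simp
    next
      case 2
      then have "u \<in> A" "length u < length h" using uv c h gK unfolding A_def by auto
      then have "u \<in> G" using "1.IH" by blast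
      then have "reduce (u @ g) \<in> G" using gG G(4) by blast
      then show ?thesis using c 2 red[OF h(1)] by simp
    next
      case 3
      then have "last (u @ inv_word v) = inv_letter t"
        using last[OF uv] c(1) h(3) by simp
      then have "hd v = t" using 3 by (simp add: last_inv_word)
      then show ?thesis using gK(3) c(2) 3 \<open>t = s\<close> by simp
    qed
  qed
  \<comment> \<open>For arbitrary \<open>k\<close>, look at the product of \<open>g\<close> and
    \<open>k\<close>. If part of \<open>g\<close> survives, the product starts like \<open>g\<close>
    and lies in \<open>A\<close>; if not, it is shorter than \<open>k\<close>.\<close>
  have "k \<in> G" if "k \<in> K" for k
    using that
  proof (induction k rule: length_induct)
    case (1 k)
    have ik: "inv_word k \<in> K" using "1.prems" subgroup_free_groupD(3)[OF K] by blast
    obtain c u v where c: "inv_word k = u @ c" "g = v @ c" "u = [] \<or> v = [] \<or> last u \<noteq> last v"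
      using longest_common_suffix[of "inv_word k" g] by blast
    have k: "k = inv_word c @ inv_word u" using c(1) by (metis inv_word_append inv_word_invol)
    have "reduced (v @ inv_word u)"
      using reduced_append_inv_word[of v c u] ik gK(1) c by auto
    then have uv: "v @ inv_word u \<in> K"
      using mult_inv_common_suffix[of v c u] ik gK(1) c by simp
    have "v @ inv_word u \<in> G"
    proof (cases "v = []")
      case True
      then show ?thesis using "1.IH" uv k c(2) gK(2) by auto
    next
      case False
      then have "v @ inv_word u \<in> A" using uv gK(3) c(2) unfolding A_def by simp
      then show ?thesis by (rule A_G)
    qed
    then have "reduce (inv_word g @ v @ inv_word u) \<in> G" using G(3,4) gG by blast
    moreover have "reduce (inv_word g @ v @ inv_word u) = reduce k"
      using reduce_append_middle[of "inv_word c" "inv_word v @ v" "inv_word u"] c(2) k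
      by (simp add: reduce_inv_left)
    ultimately show ?case using red[OF "1.prems"] by simp
  qed
  moreover have "G \<subseteq> K"
    unfolding G_def using group.generate_subgroup_incl[OF group_free_group _ K] gK(1) by simp
  ultimately show False using noncyclic[OF gK(1)] unfolding G_def by blast
qed

text \<open>Walk from the first state to the root, then around an element \<open>k\<close> of
  \<open>K\<close>, then from the root to the second state. The choice of \<open>k\<close> prevents
  cancellation at both junctions.\<close>

lemma ergodic_B_automaton:
  assumes noncyclic: "\<And>g. g \<in> K \<Longrightarrow> K \<noteq> generate free_group {g}"
    and two: "\<exists>l\<in>heads K. \<exists>l'\<in>heads K. l \<noteq> l'"
  shows "ergodic (B_automaton K)"
  unfolding ergodic_def
proof (intro ballI)
  fix q r
  assume "q \<in> states (B_automaton K)" "r \<in> states (B_automaton K)"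
  moreover obtain V y W z where q: "q = (V, y)" and r: "r = (W, z)" by (metis surj_pair)
  ultimately have st: "(V, y) \<in> B_states K" "(W, z) \<in> B_states K"
    by (simp_all add: B_simps[OF K])
  have dart: "\<exists>a b. a @ y # b \<in> K \<and> V = walk K (a @ [y])" if V: "(V, y) \<in> B_states K" for V y
  proof -
    have *: "core_step K V (inv_letter y)" using V B_states_iff[OF K] by blast
    have "core_step K (move V (inv_letter y)) y" using core_step_inv[OF K *] by simp
    then obtain a b where "a @ y # b \<in> K" "move V (inv_letter y) = walk K a"
      unfolding core_step_def by blast
    moreover have "V = move (move V (inv_letter y)) y"
      using move_inv[OF rcoset_subset_reduced[OF K core_step_rcoset[OF K *]], of "inv_letter y"] by simp
    ultimately show ?thesis by (intro exI[of _ a] exI[of _ b]) simp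
  qed
  obtain a b where ab: "a @ y # b \<in> K" "V = walk K (a @ [y])" using dart[OF st(1)] by blast
  obtain c d where cd: "c @ z # d \<in> K" "W = walk K (c @ [z])" using dart[OF st(2)] by blast
  \<comment> \<open>Keeping \<open>y\<close> and \<open>z\<close> in the words \<open>y # b\<close>
    and \<open>c @ [z]\<close> covers the cases in which \<open>b\<close> or \<open>c\<close> is
    empty.\<close>
  have s: "inv_letter (last (y # b)) \<in> heads K" using inv_last_in_heads[OF K ab(1)] by simp
  have t: "hd (c @ [z]) \<in> heads K" using hd_in_heads[OF K cd(1)] by (cases c) auto
  obtain r' where "r' \<in> heads K" "r' \<noteq> inv_letter (last (y # b))" using two by metis
  with exists_element_avoiding_letters[OF noncyclic s t] obtain k where k: "k \<in> K" "k \<noteq> []"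
    "hd k \<noteq> inv_letter (last (y # b))" "last k \<noteq> inv_letter (hd (c @ [z]))"
    by blast
  let ?w = "b @ k @ c @ [z]"
  have "reduced (y # b)" "reduced (c @ [z])" "reduced k"
    using subgroup_free_groupD(2)[OF K ab(1)] subgroup_free_groupD(2)[OF K cd(1)]
      subgroup_free_groupD(2)[OF K k(1)] by (auto simp: reduced_append reduced_Cons)
  then have "reduced ((y # b) @ k @ (c @ [z]))"
    using k inv_letter_eq_iff unfolding reduced_append
    by (metis append_is_Nil_conv hd_append2)
  moreover have "walk V b = K" using walk_mem[OF K ab(1)] ab(2) by simp
  moreover have "stays (core_step K) V b"
    using stays_core_step_factor[OF K, of "a @ [y]" b "[]"] ab by simp
  moreover have "stays (core_step K) K k"
    using stays_member[OF K k(1)] .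
  moreover have "stays (core_step K) K (c @ [z])"
    using stays_core_step_factor[OF K, of "[]" "c @ [z]" d] cd(1) by simp
  ultimately have "reduced (y # ?w) \<and> stays (core_step K) V ?w \<and> (W, z) = (walk V ?w, last (y # ?w))"
    using walk_mem[OF K k(1)] cd(2) by simp
  then show "\<exists>p. is_path (transitions (B_automaton K)) q p r"
    using is_path_B_automaton[OF K st(1)] q \<open>r = (W, z)\<close> by metis
qed

end

section \<open>Contracting a set of states\<close>

text \<open>Only the target has to lie in \<open>D\<close>, so a chain of such moves may start at a
  surviving state.\<close>

definition passes :: "('q, 'l) automaton \<Rightarrow> 'q set \<Rightarrow> ('q \<times> 'q) set" where
  "passes M D = {(p, q). \<exists>y. (p, y, q) \<in> transitions M \<and> q \<in> D}"

text \<open>A closed form, independent of any order, for collapsing all states of \<open>D\<close>.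
  The chains to initial and final states reflect that \<open>replace_state\<close> hands the role of
  a removed state to its predecessors.\<close>

definition contract :: "'q set \<Rightarrow> ('q, 'l) automaton \<Rightarrow> ('q, 'l) automaton" where
  "contract D M =
     \<lparr>states = states M - D,
      transitions = {(p, z, r). p \<notin> D \<and> r \<notin> D \<and>
        (\<exists>q. (p, q) \<in> (passes M D)\<^sup>* \<and> (q, z, r) \<in> transitions M)},
      initials = {p. p \<notin> D \<and> (\<exists>q\<in>initials M. (p, q) \<in> (passes M D)\<^sup>*)},
      finals = {p. p \<notin> D \<and> (\<exists>q\<in>finals M. (p, q) \<in> (passes M D)\<^sup>*)}\<rparr>"

lemma contract_empty: "contract {} M = M"
proof -
  have "passes M {} = {}" by (auto simp: passes_def)
  then show ?thesis by (simp add: contract_def)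
qed

lemma passes_mono: "D \<subseteq> D' \<Longrightarrow> passes M D \<subseteq> passes M D'"
  by (auto simp: passes_def)

text \<open>By acyclicity a chain meets \<open>\<sigma>\<close> at most once, so it splits there
  into two chains through \<open>D\<close>.\<close>

lemma passes_insert_rtrancl:
  assumes acyc: "(\<sigma>, \<sigma>) \<notin> (passes M (insert \<sigma> D))\<^sup>+"
  shows "(p, q) \<in> (passes M (insert \<sigma> D))\<^sup>* \<longleftrightarrow>
    (p, q) \<in> (passes M D)\<^sup>* \<or>
    (\<exists>p' y. (p, p') \<in> (passes M D)\<^sup>* \<and> (p', y, \<sigma>) \<in> transitions M \<and> (\<sigma>, q) \<in> (passes M D)\<^sup>*)"
    (is "?l \<longleftrightarrow> ?r q")
proof
  have mono: "(passes M D)\<^sup>* \<subseteq> (passes M (insert \<sigma> D))\<^sup>*"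
    by (intro rtrancl_mono passes_mono) blast
  show ?l if "?r q"
    using that
  proof
    assume "\<exists>p' y. (p, p') \<in> (passes M D)\<^sup>* \<and> (p', y, \<sigma>) \<in> transitions M \<and> (\<sigma>, q) \<in> (passes M D)\<^sup>*"
    then obtain p' y where "(p, p') \<in> (passes M D)\<^sup>*" "(p', y, \<sigma>) \<in> transitions M"
      "(\<sigma>, q) \<in> (passes M D)\<^sup>*" by blast
    moreover from this have "(p', \<sigma>) \<in> passes M (insert \<sigma> D)" by (auto simp: passes_def)
    ultimately show ?l using mono by (meson rtrancl.rtrancl_into_rtrancl rtrancl_trans subsetD)
  qed (use mono in blast)
  assume ?l
  then show "?r q"
  proof (induction rule: rtrancl_induct)
    case (step q q')
    then obtain y where y: "(q, y, q') \<in> transitions M" "q' = \<sigma> \<or> q' \<in> D"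
      by (auto simp: passes_def)
    show ?case
    proof (cases "q' \<in> D")
      case True
      then have "(q, q') \<in> passes M D" using y by (auto simp: passes_def)
      then show ?thesis using step.IH by (meson rtrancl.rtrancl_into_rtrancl)
    next
      case False
      then have [simp]: "q' = \<sigma>" using y by simp
      have "(\<sigma>, q) \<notin> (passes M D)\<^sup>*"
        using acyc step.hyps(2) mono by (auto dest!: subsetD[OF mono] rtrancl_into_trancl1)
      then show ?thesis using step.IH y(1) by auto
    qed
  qed simp
qed

text \<open>Chains avoiding \<open>\<sigma>\<close> and chains through it give the two kinds of
  transitions in \<open>collapse_state\<close>. A loop at \<open>\<sigma>\<close> after contracting
  \<open>D\<close> would be a cycle that \<open>acyc\<close> excludes.\<close>

lemma contract_insert:
  assumes "\<sigma> \<notin> D" and acyc: "(\<sigma>, \<sigma>) \<notin> (passes M (insert \<sigma> D))\<^sup>+"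
  shows "\<sigma> \<notin> predecessors (contract D M) \<sigma>"
    "contract (insert \<sigma> D) M = collapse_state \<sigma> (contract D M)"
proof -
  note rt = passes_insert_rtrancl[OF acyc]
  have pred: "p \<in> predecessors (contract D M) \<sigma> \<longleftrightarrow>
    p \<notin> D \<and> (\<exists>p' y. (p, p') \<in> (passes M D)\<^sup>* \<and> (p', y, \<sigma>) \<in> transitions M)" for p
    using \<open>\<sigma> \<notin> D\<close> unfolding predecessors_def contract_def by auto
  show nl: "\<sigma> \<notin> predecessors (contract D M) \<sigma>"
  proof
    assume "\<sigma> \<in> predecessors (contract D M) \<sigma>"
    then obtain p' y where "(\<sigma>, p') \<in> (passes M D)\<^sup>*" "(p', y, \<sigma>) \<in> transitions M"
      using pred by blast
    moreover from this have "(p', \<sigma>) \<in> passes M (insert \<sigma> D)" by (auto simp: passes_def)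
    moreover have "(passes M D)\<^sup>* \<subseteq> (passes M (insert \<sigma> D))\<^sup>*"
      by (intro rtrancl_mono passes_mono) blast
    ultimately show False using acyc by (meson rtrancl_into_trancl1 subsetD)
  qed
  \<comment> \<open>\<open>I\<close> stands for the initial as well as the final states.\<close>
  have ends: "{p. p \<notin> insert \<sigma> D \<and> (\<exists>q\<in>I. (p, q) \<in> (passes M (insert \<sigma> D))\<^sup>*)} =
    replace_state \<sigma> (predecessors (contract D M) \<sigma>) {p. p \<notin> D \<and> (\<exists>q\<in>I. (p, q) \<in> (passes M D)\<^sup>*)}"
    (is "?L = replace_state \<sigma> ?P ?J") for I
  proof -
    have "p \<in> ?L \<longleftrightarrow> p \<noteq> \<sigma> \<and> (p \<in> ?J \<or> p \<in> ?P \<and> \<sigma> \<in> ?J)" for p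
      unfolding rt pred mem_Collect_eq using \<open>\<sigma> \<notin> D\<close> by blast
    then show ?thesis using nl by (auto simp only: replace_state_def set_eq_iff split: if_splits)
  qed
  have "{(p, z, r). p \<notin> insert \<sigma> D \<and> r \<notin> insert \<sigma> D \<and>
        (\<exists>q. (p, q) \<in> (passes M (insert \<sigma> D))\<^sup>* \<and> (q, z, r) \<in> transitions M)} =
      {(p, z, r). (p, z, r) \<in> transitions (contract D M) \<and> p \<noteq> \<sigma> \<and> r \<noteq> \<sigma>} \<union>
      {(p, z, r). p \<in> predecessors (contract D M) \<sigma> \<and> (\<sigma>, z, r) \<in> transitions (contract D M)}"
    (is "?A = ?B")
  proof -
    have "(p, z, r) \<in> ?A \<longleftrightarrow> (p, z, r) \<in> ?B" for p z r
    proof -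
      have "(\<sigma>, z, \<sigma>) \<notin> transitions (contract D M)" using nl unfolding predecessors_def by blast
      moreover have "(p, z, r) \<in> transitions (contract D M) \<longleftrightarrow> p \<notin> D \<and> r \<notin> D \<and>
        (\<exists>q. (p, q) \<in> (passes M D)\<^sup>* \<and> (q, z, r) \<in> transitions M)" for p z r
        by (simp add: contract_def)
      ultimately show ?thesis
        unfolding rt mem_Collect_eq case_prod_conv Un_iff insert_iff using nl pred[of p] \<open>\<sigma> \<notin> D\<close>
        by blast
    qed
    then show ?thesis unfolding set_eq_iff split_paired_All by blast
  qed
  then show "contract (insert \<sigma> D) M = collapse_state \<sigma> (contract D M)"
    unfolding collapse_state_def contract_def[of "insert \<sigma> D"] ends
    by (auto simp: contract_def)
qed

text \<open>Acyclicity passes to subsets of \<open>D\<close>, so the states can be collapsed one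
  after another.\<close>

lemma collapse_steps_contract:
  assumes "finite D" "D \<subseteq> states M" "\<And>d. d \<in> D \<Longrightarrow> (d, d) \<notin> (passes M D)\<^sup>+"
  shows "collapse_step\<^sup>*\<^sup>* M (contract D M)"
  using assms
proof (induction D rule: finite_induct)
  case empty
  then show ?case by (simp add: contract_empty)
next
  case (insert \<sigma> D)
  have "(passes M D)\<^sup>+ \<subseteq> (passes M (insert \<sigma> D))\<^sup>+"
    by (intro trancl_mono_subset passes_mono) blast
  then have "collapse_step\<^sup>*\<^sup>* M (contract D M)"
    using insert.prems by (intro insert.IH) auto
  moreover have "collapse_step (contract D M) (contract (insert \<sigma> D) M)"
    using contract_insert[OF insert.hyps(2) insert.prems(2)] insert.prems(1) insert.hyps(2)
    unfolding collapse_step_def by (auto simp: contract_def)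
  ultimately show ?case by (rule rtranclp.rtrancl_into_rtrancl)
qed

section \<open>Ergodicity under collapsing and isomorphism\<close>

definition steps :: "('q, 'l) automaton \<Rightarrow> ('q \<times> 'q) set" where
  "steps M = {(p, q). \<exists>y. (p, y, q) \<in> transitions M}"

lemma ergodic_iff: "ergodic M \<longleftrightarrow> (\<forall>q\<in>states M. \<forall>r\<in>states M. (q, r) \<in> (steps M)\<^sup>*)"
proof -
  have "(q, r) \<in> (steps M)\<^sup>*" if "is_path (transitions M) q p r" for p q r
    using that
  proof (induction p arbitrary: q)
    case (Cons e p)
    then obtain y w where "(q, w) \<in> steps M" "(w, r) \<in> (steps M)\<^sup>*"
      by (cases e) (auto simp: steps_def)
    then show ?case by (rule converse_rtrancl_into_rtrancl)
  qed simp
  moreover have "\<exists>p. is_path (transitions M) q p r" if "(q, r) \<in> (steps M)\<^sup>*" for q r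
    using that
  proof (induction rule: converse_rtrancl_induct)
    case base
    have "is_path (transitions M) r [] r" by simp
    then show ?case ..
  next
    case (step q w)
    then obtain y p where "is_path (transitions M) q ((q, y, w) # p) r" by (auto simp: steps_def)
    then show ?case ..
  qed
  ultimately show ?thesis unfolding ergodic_def by blast
qed

lemma ergodic_collapse_step:
  assumes "ergodic M" "collapse_step M M'"
  shows "ergodic M'"
proof -
  obtain \<sigma> where \<sigma>: "\<sigma> \<notin> predecessors M \<sigma>" "M' = collapse_state \<sigma> M"
    using assms(2) unfolding collapse_step_def by blast
  \<comment> \<open>The second conjunct strengthens the induction: a path that starts at the
    vanished \<open>\<sigma>\<close> has to be resumed from each predecessor of
    \<open>\<sigma>\<close>.\<close>
  have "(p \<noteq> \<sigma> \<longrightarrow> (p, q) \<in> (steps M')\<^sup>*) \<and>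
    (p = \<sigma> \<longrightarrow> (\<forall>p'\<in>predecessors M \<sigma>. (p', q) \<in> (steps M')\<^sup>*))"
    if "(p, q) \<in> (steps M)\<^sup>*" "q \<noteq> \<sigma>" for p q
    using that
  proof (induction rule: converse_rtrancl_induct)
    case (step p r)
    obtain y where y: "(p, y, r) \<in> transitions M" using step.hyps(1) by (auto simp: steps_def)
    show ?case
    proof (cases "p = \<sigma>")
      case True
      then have "r \<noteq> \<sigma>" using \<sigma>(1) y by (auto simp: predecessors_def)
      moreover have "(p', r) \<in> steps M'" if "p' \<in> predecessors M \<sigma>" for p'
        using that y True by (auto simp: steps_def \<sigma>(2) collapse_state_def)
      ultimately show ?thesis
        using step True by (meson converse_rtrancl_into_rtrancl)
    next
      case False
      show ?thesis
      proof (cases "r = \<sigma>")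
        case True
        then have "p \<in> predecessors M \<sigma>" using y by (auto simp: predecessors_def)
        then show ?thesis using step True False by blast
      next
        case r: False
        then have "(p, r) \<in> steps M'" using y False by (auto simp: steps_def \<sigma>(2) collapse_state_def)
        then show ?thesis using step False r by (meson converse_rtrancl_into_rtrancl)
      qed
    qed
  qed simp
  then show ?thesis using assms(1) \<sigma>(2) unfolding ergodic_iff by (auto simp: collapse_state_def)
qed

lemma ergodic_automaton_iso:
  assumes "ergodic M" "automaton_iso M N"
  shows "ergodic N"
proof -
  obtain h where h: "bij_betw h (states M) (states N)"
    "(\<lambda>(p, z, q). (h p, z, h q)) ` transitions M = transitions N"
    using assms(2) unfolding automaton_iso_def by blast
  have "(h p, h q) \<in> (steps N)\<^sup>*" if "(p, q) \<in> (steps M)\<^sup>*" for p q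
    using that
  proof (induction rule: rtrancl_induct)
    case (step q r)
    then obtain y where "(q, y, r) \<in> transitions M" by (auto simp: steps_def)
    then have "(h q, y, h r) \<in> transitions N" unfolding h(2)[symmetric] by force
    then have "(h q, h r) \<in> steps N" by (auto simp: steps_def)
    with step.IH show ?case by (rule rtrancl_into_rtrancl)
  qed simp
  then show ?thesis
    using assms(1) unfolding ergodic_iff bij_betw_imp_surj_on[OF h(1), symmetric] by blast
qed

lemma ergodic_automaton_collapse:
  assumes "ergodic M" "automaton_collapse M N"
  shows "ergodic N"
proof -
  obtain M' where "collapse_step\<^sup>*\<^sup>* M M'" "automaton_iso M' N"
    using assms(2) unfolding automaton_collapse_def by blast
  from this(1) have "ergodic M'"
    using assms(1) by induction (blast intro: ergodic_collapse_step)+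
  then show ?thesis using \<open>automaton_iso M' N\<close> by (rule ergodic_automaton_iso)
qed

section \<open>Labellings of coset graphs\<close>

lemma hom_eq_on_generate:
  assumes "group G" "group Q" "f \<in> hom G Q" "g \<in> hom G Q" "S \<subseteq> carrier G"
    "\<And>s. s \<in> S \<Longrightarrow> f s = g s" "x \<in> generate G S"
  shows "f x = g x"
proof -
  interpret f: group_hom G Q f using assms by (simp add: group_hom_def group_hom_axioms_def)
  interpret g: group_hom G Q g using assms by (simp add: group_hom_def group_hom_axioms_def)
  show ?thesis
    using assms(7)
  proof induction
    case (inv a)
    then have "a \<in> carrier G" using assms(5) by blast
    then show ?case using assms(6)[OF inv] by simp
  next
    case (eng h1 h2)
    then have "h1 \<in> carrier G" "h2 \<in> carrier G"
      using group.generate_in_carrier[OF assms(1,5)] by blast+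
    then show ?case using eng.IH by simp
  qed (simp_all add: assms(6))
qed

text \<open>Composing with \<open>\<theta>\<close> permutes the finite set of homomorphisms from \<open>G\<close> to \<open>Q\<close>, so every
  such homomorphism factors through \<open>\<theta>\<close>.\<close>

lemma hom_finite_trivial_on_kernel:
  assumes G: "group G" "finite S" "S \<subseteq> carrier G" "generate G S = carrier G"
    and Q: "group Q" "finite (carrier Q)" and \<chi>: "\<chi> \<in> hom G Q"
    and \<theta>: "\<theta> \<in> hom G G" "\<theta> ` carrier G = carrier G"
    and g: "g \<in> carrier G" "\<theta> g = \<one>\<^bsub>G\<^esub>"
  shows "\<chi> g = \<one>\<^bsub>Q\<^esub>"
proof -
  \<comment> \<open>Fixing the values off the carrier makes homomorphisms that agree on the carrier
    equal, without which the set could be infinite.\<close>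
  define Hs where "Hs = hom G Q \<inter> extensional (carrier G)"
  define precomp where "precomp f = restrict (\<lambda>x. f (\<theta> x)) (carrier G)" for f :: "_ \<Rightarrow> 'c"
  have cong: "restrict \<chi> (carrier G) \<in> Hs" if "\<chi> \<in> hom G Q" for \<chi>
    using that monoid.m_closed[OF group.is_monoid[OF G(1)]] by (auto simp: Hs_def hom_def)
  have "inj_on (\<lambda>\<chi>. restrict \<chi> S) Hs"
  proof (rule inj_onI)
    fix f h assume fh: "f \<in> Hs" "h \<in> Hs" and eq: "restrict f S = restrict h S"
    have "f s = h s" if "s \<in> S" for s using eq that by (metis restrict_apply')
    then have "f x = h x" if "x \<in> carrier G" for x
      using hom_eq_on_generate[OF G(1) Q(1), of f h S x] fh G that by (simp add: Hs_def)
    then show "f = h" using fh by (intro extensionalityI[of f "carrier G" h]) (auto simp: Hs_def)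
  qed
  moreover have "(\<lambda>\<chi>. restrict \<chi> S) ` Hs \<subseteq> S \<rightarrow>\<^sub>E carrier Q"
    using G(3) by (auto simp: Hs_def hom_def Pi_iff)
  ultimately have "finite Hs"
    using finite_PiE[OF G(2), of "\<lambda>_. carrier Q"] Q(2) by (meson finite_imageD finite_subset)
  moreover have "precomp ` Hs \<subseteq> Hs"
    using cong hom_compose[OF \<theta>(1), of _ Q] by (auto simp: precomp_def Hs_def comp_def)
  moreover have "inj_on precomp Hs"
  proof (rule inj_onI)
    fix f h assume fh: "f \<in> Hs" "h \<in> Hs" and eq: "precomp f = precomp h"
    have "f x = h x" if "x \<in> carrier G" for x
    proof -
      obtain y where y: "y \<in> carrier G" "x = \<theta> y" using \<theta>(2) \<open>x \<in> carrier G\<close> by blast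
      have "precomp f y = precomp h y" using eq by simp
      then show ?thesis using y by (simp add: precomp_def)
    qed
    then show "f = h" using fh by (intro extensionalityI[of f "carrier G" h]) (auto simp: Hs_def)
  qed
  ultimately have "precomp ` Hs = Hs" by (rule endo_inj_surj)
  then obtain f where f: "f \<in> Hs" "restrict \<chi> (carrier G) = precomp f" using cong[OF \<chi>] by blast
  have "\<chi> g = restrict \<chi> (carrier G) g" using g(1) by simp
  also have "\<dots> = f (\<theta> g)" unfolding f(2) using g(1) by (simp add: precomp_def)
  also have "\<dots> = \<one>\<^bsub>Q\<^esub>" using g(2) hom_one[OF _ G(1) Q(1), of f] f(1) by (simp add: Hs_def)
  finally show ?thesis .
qed

section \<open>Products of edge labels along walks\<close>

fun coset_eval :: "('q, 'm) monoid_scheme \<Rightarrow> ('x word set \<Rightarrow> 'x letter \<Rightarrow> 'q) \<Rightarrow> 'x word set \<Rightarrow> 'x word \<Rightarrow> 'q" where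
  "coset_eval Q c V [] = \<one>\<^bsub>Q\<^esub>"
| "coset_eval Q c V (y # w) = c V y \<otimes>\<^bsub>Q\<^esub> coset_eval Q c (move V y) w"

text \<open>Used twice: with \<open>erase\<close>, which has values in the free group, and with the
  crossing count modulo 2.\<close>

locale coset_labelling = Q: group Q
  for Q :: "('q, 'm) monoid_scheme" +
  fixes c :: "'x word set \<Rightarrow> 'x letter \<Rightarrow> 'q"
  assumes label_closed: "V \<subseteq> Collect reduced \<Longrightarrow> c V y \<in> carrier Q"
    and label_inv: "V \<subseteq> Collect reduced \<Longrightarrow> c (move V y) (inv_letter y) = inv\<^bsub>Q\<^esub> c V y"
begin

lemma eval_closed: "V \<subseteq> Collect reduced \<Longrightarrow> coset_eval Q c V w \<in> carrier Q"
  by (induction w arbitrary: V) (simp_all add: label_closed move_subset)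

lemma eval_append:
  "V \<subseteq> Collect reduced \<Longrightarrow>
     coset_eval Q c V (u @ v) = coset_eval Q c V u \<otimes>\<^bsub>Q\<^esub> coset_eval Q c (walk V u) v"
proof (induction u arbitrary: V)
  case (Cons y u)
  then show ?case
    using Cons.IH[OF move_subset, of V y] eval_closed[OF move_subset, of V y]
      eval_closed[OF walk_subset[OF move_subset], of V y] label_closed[of V y]
    by (simp add: Q.m_assoc)
qed (simp add: eval_closed)

text \<open>A step and its reverse carry inverse labels, so a cancelling pair of letters contributes
  nothing.\<close>

lemma eval_reduce: "V \<subseteq> Collect reduced \<Longrightarrow> coset_eval Q c V (reduce w) = coset_eval Q c V w"
proof (induction w arbitrary: V)
  case (Cons y w)
  have IH: "coset_eval Q c (move V y) (reduce w) = coset_eval Q c (move V y) w"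
    by (rule Cons.IH[OF move_subset])
  show ?case
  proof (cases "\<exists>u. reduce w = inv_letter y # u")
    case True
    then obtain u where u: "reduce w = inv_letter y # u" by blast
    have "coset_eval Q c (move V y) w = inv\<^bsub>Q\<^esub> c V y \<otimes>\<^bsub>Q\<^esub> coset_eval Q c V u"
      using IH u move_inv[OF Cons.prems] label_inv[OF Cons.prems] by simp
    then have "coset_eval Q c V (y # w) = coset_eval Q c V u"
      using label_closed[OF Cons.prems, of y] eval_closed[OF Cons.prems, of u]
      by (simp add: Q.m_assoc[symmetric])
    then show ?thesis using u by (simp add: reduce_Cons)
  next
    case False
    then have "reduce (y # w) = y # reduce w"
      by (cases "reduce w") (auto simp: reduce_Cons)
    then show ?thesis using IH by simp
  qed
qed simp

lemma eval_inv_word: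
  assumes "V \<subseteq> Collect reduced"
  shows "coset_eval Q c (walk V w) (inv_word w) = inv\<^bsub>Q\<^esub> coset_eval Q c V w"
proof -
  have "coset_eval Q c V (w @ inv_word w) = \<one>\<^bsub>Q\<^esub>"
    using eval_reduce[OF assms, of "w @ inv_word w"] by (simp add: reduce_inv_right)
  then have "coset_eval Q c V w \<otimes>\<^bsub>Q\<^esub> coset_eval Q c (walk V w) (inv_word w) = \<one>\<^bsub>Q\<^esub>"
    using eval_append[OF assms] by simp
  then show ?thesis
    using Q.inv_solve_left[of "coset_eval Q c (walk V w) (inv_word w)" "coset_eval Q c V w" "\<one>\<^bsub>Q\<^esub>"]
      eval_closed[OF assms] eval_closed[OF walk_subset[OF assms]] by (simp add: Q.inv_equality Q.inv_comm)
qed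

text \<open>Elements of \<open>K\<close> walk back to the root, so in \<open>eval_append\<close> the
  second factor is again evaluated from the root.\<close>

lemma eval_hom:
  assumes K: "subgroup K free_group"
  shows "coset_eval Q c K \<in> hom (free_group\<lparr>carrier := K\<rparr>) Q"
  using eval_closed[OF subgroup_subset_reduced[OF K]] eval_reduce[OF subgroup_subset_reduced[OF K]]
    eval_append[OF subgroup_subset_reduced[OF K]] walk_mem[OF K]
  by (intro homI) simp_all

end

section \<open>Contractions of cores\<close>

text \<open>The content of \<open>graph_collapse\<close> for two cores, with \<open>S\<close> and
  \<open>f\<close> fixed. Here \<open>K\<close> is any subgroup; the injective homomorphism enters
  in \<open>no_collapsed_cycle\<close>.\<close>

locale core_contraction =
  fixes H K :: "'x word set" and S :: "('x word set \<times> 'x \<times> 'x word set) set"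
    and f :: "'x word set \<Rightarrow> 'x word set"
  assumes H: "subgroup H free_group" and K: "subgroup K free_group"
    and S: "S \<subseteq> edges (core H)"
    and f_verts: "f ` verts (core H) = verts (core K)"
    and f_root: "f H = K"
    and f_eq_iff: "u \<in> verts (core H) \<Longrightarrow> v \<in> verts (core H) \<Longrightarrow>
      f u = f v \<longleftrightarrow> (u, v) \<in> ({(u, v). \<exists>x. (u, x, v) \<in> S} \<union> {(u, v). \<exists>x. (u, x, v) \<in> S}\<inverse>)\<^sup>*"
    and f_edges: "bij_betw (\<lambda>(u, x, v). (f u, x, f v)) (edges (core H) - S) (edges (core K))"
begin

abbreviation links :: "('x word set \<times> 'x word set) set" where
  "links \<equiv> {(u, v). \<exists>x. (u, x, v) \<in> S} \<union> {(u, v). \<exists>x. (u, x, v) \<in> S}\<inverse>"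

text \<open>Extends \<open>S\<close>, whose edges carry positive labels, to both directions of
  travel.\<close>

definition collapsed :: "'x word set \<Rightarrow> 'x letter \<Rightarrow> bool" where
  "collapsed V y \<longleftrightarrow> (if snd y then (V, fst y, move V y) \<in> S else (move V y, fst y, V) \<in> S)"

lemma edges_core_iff:
  "subgroup L free_group \<Longrightarrow>
     (u, x, v) \<in> edges (core L) \<longleftrightarrow> core_step L u (x, True) \<and> v = move u (x, True)"
  by (simp add: core_def core_edges_iff)

lemma collapsed_inv_iff:
  "V \<subseteq> Collect reduced \<Longrightarrow> collapsed (move V y) (inv_letter y) \<longleftrightarrow> collapsed V y"
  by (simp add: collapsed_def move_inv) (simp add: inv_letter_def)

lemma vert_subset: "V \<in> verts (core H) \<Longrightarrow> V \<subseteq> Collect reduced"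
  using rcoset_subset_reduced[OF H] core_step_rcoset[OF H] root_in_rcosets[OF H]
  by (auto simp only: verts_core[OF H])

lemma root_vert: "H \<in> verts (core H)"
  by (simp add: verts_core[OF H])

lemma core_step_subset: "core_step H V y \<Longrightarrow> V \<subseteq> Collect reduced"
  using rcoset_subset_reduced[OF H] core_step_rcoset[OF H] by blast

lemma core_step_verts:
  assumes "core_step H V y"
  shows "V \<in> verts (core H)" "move V y \<in> verts (core H)"
  using assms core_step_inv[OF H assms] unfolding verts_core[OF H] by blast+

lemma collapsed_core_step:
  assumes "V \<subseteq> Collect reduced" "collapsed V y"
  shows "core_step H V y"
proof (cases "snd y")
  case True
  then have "core_step H V (fst y, True)"
    using assms(2) S edges_core_iff[OF H] unfolding collapsed_def by auto
  then show ?thesis using True by (metis prod.collapse)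
next
  case False
  then have y: "inv_letter y = (fst y, True)" by (simp add: inv_letter_def)
  have "(move V y, fst y, V) \<in> edges (core H)" using False assms(2) S unfolding collapsed_def by auto
  then have "core_step H (move V y) (inv_letter y)" unfolding edges_core_iff[OF H] y by blast
  then show ?thesis using core_step_inv_iff[OF H assms(1)] by blast
qed

lemma collapsed_f:
  assumes "V \<subseteq> Collect reduced" "collapsed V y"
  shows "f (move V y) = f V"
proof -
  have "(V, move V y) \<in> links"
    using assms(2) unfolding collapsed_def by (auto split: if_splits)
  then show ?thesis
    using f_eq_iff core_step_verts[OF collapsed_core_step[OF assms]] by blast
qed

text \<open>Darts are oriented core edges. Here and in \<open>dart_surj\<close> and
  \<open>dart_inj\<close>, \<open>f_edges\<close> is carried over from positive edges to darts; a
  negative letter is treated by reversing the dart.\<close>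

lemma dart_map:
  assumes "core_step H V y" "\<not> collapsed V y"
  shows "core_step K (f V) y" "move (f V) y = f (move V y)"
proof -
  have pos: "core_step K (f V) (x, True) \<and> move (f V) (x, True) = f (move V (x, True))"
    if "core_step H V (x, True)" "\<not> collapsed V (x, True)" for V x
  proof -
    have "(V, x, move V (x, True)) \<in> edges (core H) - S"
      using that by (auto simp: edges_core_iff[OF H] collapsed_def)
    then have "(f V, x, f (move V (x, True))) \<in> edges (core K)"
      using bij_betw_imp_surj_on[OF f_edges] by force
    then show ?thesis by (auto simp: edges_core_iff[OF K])
  qed
  have "core_step K (f V) y \<and> move (f V) y = f (move V y)"
  proof (cases "snd y")
    case True
    then show ?thesis using pos[of V "fst y"] assms by (metis prod.collapse)
  next
    case False
    then have y: "inv_letter y = (fst y, True)" by (simp add: inv_letter_def)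
    note sub = core_step_subset[OF assms(1)]
    have "core_step H (move V y) (inv_letter y)" "\<not> collapsed (move V y) (inv_letter y)"
      using core_step_inv[OF H assms(1)] assms(2) collapsed_inv_iff[OF sub] by blast+
    then have *: "core_step K (f (move V y)) (inv_letter y)" "move (f (move V y)) (inv_letter y) = f V"
      using pos[of "move V y" "fst y"] move_inv[OF sub, of y] unfolding y by simp_all
    have "core_step K (f V) y"
      using core_step_inv[OF K *(1)] *(2) by simp
    moreover have "move (f V) y = f (move V y)"
      using move_inv[OF rcoset_subset_reduced[OF K core_step_rcoset[OF K *(1)]], of "inv_letter y"] *(2)
      by simp
    ultimately show ?thesis ..
  qed
  then show "core_step K (f V) y" "move (f V) y = f (move V y)" by blast+
qed

lemma dart_surj:
  assumes "core_step K W y"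
  obtains V where "core_step H V y" "\<not> collapsed V y" "f V = W"
proof -
  have pos: "\<exists>V. core_step H V (x, True) \<and> \<not> collapsed V (x, True) \<and> f V = W"
    if "core_step K W (x, True)" for W x
  proof -
    have "(W, x, move W (x, True)) \<in> (\<lambda>(u, x, v). (f u, x, f v)) ` (edges (core H) - S)"
      using that unfolding bij_betw_imp_surj_on[OF f_edges] edges_core_iff[OF K] by blast
    then obtain u v where "(u, x, v) \<in> edges (core H) - S" "f u = W" by auto
    then show ?thesis by (auto simp: edges_core_iff[OF H] collapsed_def)
  qed
  show thesis
  proof (cases "snd y")
    case True
    then show ?thesis using pos[of W "fst y"] assms that by (metis prod.collapse)
  next
    case False
    then have y: "inv_letter y = (fst y, True)" by (simp add: inv_letter_def)
    have "core_step K (move W y) (inv_letter y)" using core_step_inv[OF K assms] .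
    then obtain U where U: "core_step H U (inv_letter y)" "\<not> collapsed U (inv_letter y)" "f U = move W y"
      using pos[of "move W y" "fst y"] unfolding y by blast
    note sub = core_step_subset[OF U(1)]
    have "core_step H (move U (inv_letter y)) y" "\<not> collapsed (move U (inv_letter y)) y"
      using core_step_inv[OF H U(1)] U(2) collapsed_inv_iff[OF sub, of "inv_letter y"] by simp_all
    moreover have "f (move U (inv_letter y)) = W"
      using dart_map(2)[OF U(1,2)] U(3)
        move_inv[OF rcoset_subset_reduced[OF K core_step_rcoset[OF K assms]], of y] by simp
    ultimately show ?thesis using that by blast
  qed
qed

text \<open>Injectivity of \<open>f_edges\<close> concerns whole triples, but the image of the
  origin and the letter already determine the image of the terminus.\<close>

lemma dart_inj:
  assumes V: "core_step H V y" "\<not> collapsed V y" and W: "core_step H W y" "\<not> collapsed W y"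
    and eq: "f V = f W"
  shows "V = W"
proof -
  have pos: "V = W" if V: "core_step H V (x, True)" "\<not> collapsed V (x, True)"
    and W: "core_step H W (x, True)" "\<not> collapsed W (x, True)" and eq: "f V = f W" for V W x
  proof -
    have "(V, x, move V (x, True)) \<in> edges (core H) - S" "(W, x, move W (x, True)) \<in> edges (core H) - S"
      using V W by (auto simp: edges_core_iff[OF H] collapsed_def)
    moreover have "f (move V (x, True)) = f (move W (x, True))"
      using dart_map(2)[OF V] dart_map(2)[OF W] eq by simp
    ultimately show ?thesis
      using inj_onD[OF bij_betw_imp_inj_on[OF f_edges],
          of "(V, x, move V (x, True))" "(W, x, move W (x, True))"] eq by simp
  qed
  show ?thesis
  proof (cases "snd y")
    case True
    then show ?thesis using pos[of V "fst y" W] assms by (metis prod.collapse)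
  next
    case False
    then have y: "inv_letter y = (fst y, True)" by (simp add: inv_letter_def)
    note subV = core_step_subset[OF V(1)] and subW = core_step_subset[OF W(1)]
    have "f (move V y) = f (move W y)"
      using dart_map(2)[OF V] dart_map(2)[OF W] eq by simp
    moreover have "core_step H (move V y) (inv_letter y)" "\<not> collapsed (move V y) (inv_letter y)"
      "core_step H (move W y) (inv_letter y)" "\<not> collapsed (move W y) (inv_letter y)"
      using core_step_inv[OF H] V W collapsed_inv_iff subV subW by blast+
    ultimately have "move V y = move W y" using pos unfolding y by blast
    then show ?thesis using move_inv[OF subV, of y] move_inv[OF subW, of y] by metis
  qed
qed

lemma stays_core_step_verts:
  "V \<in> verts (core H) \<Longrightarrow> stays (core_step H) V w \<Longrightarrow> walk V w \<in> verts (core H)"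
  by (induction w arbitrary: V) (auto simp: core_step_verts)

lemma stays_collapsed_core_step:
  "V \<subseteq> Collect reduced \<Longrightarrow> stays collapsed V w \<Longrightarrow> stays (core_step H) V w"
  by (induction w arbitrary: V) (auto simp: collapsed_core_step move_subset)

lemma stays_collapsed_f:
  "V \<subseteq> Collect reduced \<Longrightarrow> stays collapsed V w \<Longrightarrow> f (walk V w) = f V"
  by (induction w arbitrary: V) (auto simp: collapsed_f move_subset)

text \<open>A chain of links spells a word of collapsed steps, and by \<open>stays_reduce\<close>
  its reduction still uses collapsed steps only.\<close>

lemma collapsed_connected:
  assumes "V \<in> verts (core H)" "W \<in> verts (core H)" "f V = f W"
  obtains w where "reduced w" "stays collapsed V w" "walk V w = W"
proof -
  have "(V, W) \<in> links\<^sup>*" using f_eq_iff assms by blast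
  then have "\<exists>w. stays collapsed V w \<and> walk V w = W"
  proof (induction rule: rtrancl_induct)
    case base
    show ?case by (rule exI[of _ "[]"]) simp
  next
    case (step U U')
    then obtain w where w: "stays collapsed V w" "walk V w = U" by blast
    have U: "U \<subseteq> Collect reduced"
      using walk_subset[OF vert_subset[OF assms(1)], of w] w(2) by simp
    have "\<exists>y. collapsed U y \<and> move U y = U'"
    proof -
      from step.hyps(2) consider x where "(U, x, U') \<in> S" | x where "(U', x, U) \<in> S" by blast
      then show ?thesis
      proof cases
        case 1
        then have "U' = move U (x, True)" using S edges_core_iff[OF H] by blast
        then show ?thesis using 1 by (intro exI[of _ "(x, True)"]) (simp add: collapsed_def)
      next
        case 2
        then have U': "core_step H U' (x, True)" "U = move U' (x, True)"
          using S edges_core_iff[OF H] by blast+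
        have "move U (x, False) = U'"
          using move_inv[OF core_step_subset[OF U'(1)], of "(x, True)"] unfolding U'(2)
          by (simp add: inv_letter_def)
        then show ?thesis using 2 by (intro exI[of _ "(x, False)"]) (simp add: collapsed_def)
      qed
    qed
    then obtain y where "collapsed U y" "move U y = U'" by blast
    then have "stays collapsed V (w @ [y]) \<and> walk V (w @ [y]) = U'" using w by simp
    then show ?case by blast
  qed
  then obtain w where "stays collapsed V w" "walk V w = W" by blast
  then show thesis
    using that[of "reduce w"] stays_reduce[OF vert_subset[OF assms(1)]]
      walk_reduce[OF vert_subset[OF assms(1)]] by simp
qed

section \<open>The surjection that erases collapsed letters\<close>

definition erase :: "'x word set \<Rightarrow> 'x letter \<Rightarrow> 'x word" where
  "erase V y = (if core_step H V y \<and> \<not> collapsed V y then [y] else [])"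

text \<open>Steps outside the core are erased too, so the label is defined and compatible with
  reversal at every coset.\<close>

sublocale erase: coset_labelling free_group erase
proof -
  interpret group free_group by (rule group_free_group)
  show "coset_labelling free_group erase"
  proof
    fix V :: "'x word set" and y assume V: "V \<subseteq> Collect reduced"
    show "erase V y \<in> carrier free_group" by (simp add: erase_def)
    show "erase (move V y) (inv_letter y) = inv\<^bsub>free_group\<^esub> erase V y"
      using core_step_inv_iff[OF H V, of y] collapsed_inv_iff[OF V, of y]
      by (simp add: erase_def inv_word_def)
  qed
qed

abbreviation "erase_word \<equiv> coset_eval free_group erase"

text \<open>A collapsed step does not change the image under \<open>f\<close>, and every other core
  step is mapped to a step with the same letter.\<close>

lemma walk_erase_word:
  assumes "V \<in> verts (core H)" "stays (core_step H) V w"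
  shows "walk (f V) (erase_word V w) = f (walk V w)"
  using assms
proof (induction w arbitrary: V)
  case (Cons y w)
  then have y: "core_step H V y" and w: "stays (core_step H) (move V y) w" by simp_all
  have "f V \<in> verts (core K)" using Cons.prems(1) f_verts by blast
  then have fV: "f V \<subseteq> Collect reduced"
    using rcoset_subset_reduced[OF K] core_step_rcoset[OF K] root_in_rcosets[OF K]
    by (auto simp only: verts_core[OF K])
  have "walk (f V) (erase_word V (y # w)) = walk (walk (f V) (erase V y)) (erase_word (move V y) w)"
    by (simp add: walk_reduce[OF fV])
  also have "walk (f V) (erase V y) = f (move V y)"
    using dart_map(2)[OF y] collapsed_f[OF core_step_subset[OF y]] y by (simp add: erase_def)
  also have "walk \<dots> (erase_word (move V y) w) = f (walk (move V y) w)"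
    by (rule Cons.IH[OF core_step_verts(2)[OF y] w])
  finally show ?case by simp
qed simp

lemma erase_word_collapsed: "stays collapsed V w \<Longrightarrow> erase_word V w = []"
  by (induction w arbitrary: V) (simp_all add: erase_def)

lemma erase_word_in: "w \<in> H \<Longrightarrow> erase_word H w \<in> K"
proof -
  assume w: "w \<in> H"
  have "walk K (erase_word H w) = K"
    using walk_erase_word[OF root_vert stays_member[OF H w]] walk_mem[OF H w] f_root by simp
  moreover have "reduced (erase_word H w)"
    using erase.eval_closed[OF subgroup_subset_reduced[OF H]] by simp
  ultimately show ?thesis using walk_subgroup_eq_iff[OF K] by simp
qed

text \<open>Consecutive letters lift to darts that meet only in a common fibre of \<open>f\<close>.
  A collapsed walk inside the fibre bridges the gap and is erased again.\<close>

lemma lift_word: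
  assumes "V \<in> verts (core H)" "stays (core_step K) (f V) k"
  shows "\<exists>w. stays (core_step H) V w \<and> erase_word V w = reduce k \<and> f (walk V w) = walk (f V) k"
  using assms
proof (induction k arbitrary: V)
  case Nil
  show ?case by (rule exI[of _ "[]"]) simp
next
  case (Cons y k)
  then have "core_step K (f V) y" by simp
  then obtain U where U: "core_step H U y" "\<not> collapsed U y" "f U = f V" by (rule dart_surj)
  obtain w0 where w0: "stays collapsed V w0" "walk V w0 = U"
    using collapsed_connected[OF Cons.prems(1) core_step_verts(1)[OF U(1)]] U(3) by metis
  have "stays (core_step K) (f (move U y)) k"
    using Cons.prems(2) dart_map(2)[OF U(1,2)] U(3) by simp
  then obtain w where w: "stays (core_step H) (move U y) w" "erase_word (move U y) w = reduce k"
    "f (walk (move U y) w) = walk (f (move U y)) k"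
    using Cons.IH[OF core_step_verts(2)[OF U(1)]] by blast
  note V = vert_subset[OF Cons.prems(1)]
  have "stays (core_step H) V (w0 @ y # w)"
    using stays_collapsed_core_step[OF V w0(1)] w0(2) U(1) w(1) by simp
  moreover have "erase_word V (w0 @ y # w) = reduce (y # k)"
    using erase.eval_append[OF V, of w0 "y # w"] erase_word_collapsed[OF w0(1)] w0(2) w(2) U(1,2)
      reduce_append_right[of "[y]" k] by (simp add: erase_def)
  moreover have "f (walk V (w0 @ y # w)) = walk (f V) (y # k)"
    using w0(2) w(3) dart_map(2)[OF U(1,2)] U(3) by simp
  ultimately show ?case by blast
qed

text \<open>A lift of a closed walk ends in the fibre of the root; a collapsed walk leads back to
  the root without changing the erased word.\<close>

lemma erase_word_surj: "erase_word H ` H = K"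
proof
  show "erase_word H ` H \<subseteq> K" using erase_word_in by blast
  show "K \<subseteq> erase_word H ` H"
  proof
    fix k assume k: "k \<in> K"
    have "stays (core_step K) (f H) k" using stays_member[OF K k] f_root by simp
    then obtain w where w: "stays (core_step H) H w" "erase_word H w = reduce k" "f (walk H w) = K"
      using lift_word[OF root_vert] walk_mem[OF K k] f_root by metis
    note sub = subgroup_subset_reduced[OF H]
    obtain u where u: "stays collapsed (walk H w) u" "walk (walk H w) u = H"
      using collapsed_connected[OF stays_core_step_verts[OF root_vert w(1)] root_vert] w(3) f_root by metis
    have "reduce (w @ u) \<in> H" using walk_subgroup_eq_iff[OF H, of "w @ u"] u(2) by simp
    moreover have "erase_word H (reduce (w @ u)) = k"
      using erase.eval_reduce[OF sub] erase.eval_append[OF sub, of w u] erase_word_collapsed[OF u(1)]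
        w(2) subgroup_free_groupD(2)[OF K k] by simp
    ultimately show "k \<in> erase_word H ` H" by blast
  qed
qed

end

section \<open>The contracted edges form a forest\<close>

lemma stays_if_factors:
  assumes "\<And>a z b. w = a @ z # b \<Longrightarrow> P (walk V a) z"
  shows "stays P V w"
  using assms
proof (induction w arbitrary: V)
  case (Cons y w)
  have "P V y" using Cons.prems[of "[]" y w] by simp
  moreover have "stays P (move V y) w"
    using Cons.prems[of "y # _"] by (intro Cons.IH) simp
  ultimately show ?case by simp
qed simp

lemma (in coset_labelling) eval_trivial:
  "stays (\<lambda>U z. c U z = \<one>\<^bsub>Q\<^esub>) V w \<Longrightarrow> coset_eval Q c V w = \<one>\<^bsub>Q\<^esub>"
  by (induction w arbitrary: V) simp_all

lemma (in coset_labelling) eval_conjugate: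
  assumes "V \<subseteq> Collect reduced" "walk (walk V p) w = walk V p"
  shows "coset_eval Q c V (p @ w @ inv_word p) =
    coset_eval Q c V p \<otimes>\<^bsub>Q\<^esub> (coset_eval Q c (walk V p) w \<otimes>\<^bsub>Q\<^esub> inv\<^bsub>Q\<^esub> coset_eval Q c V p)"
  using eval_append[OF assms(1), of p] eval_append[OF walk_subset[OF assms(1)], of p w]
    eval_inv_word[OF assms(1), of p] assms(2) by simp

context core_contraction
begin

lemma vert_word:
  assumes "V \<in> verts (core H)"
  obtains p where "walk H p = V"
proof -
  consider "V = H" | y where "core_step H V y" using assms unfolding verts_core[OF H] by blast
  then show thesis
  proof cases
    case 1
    then show thesis using that[of "[]"] by simp
  next
    case 2
    then show thesis using that unfolding core_step_def by blast
  qed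
qed

text \<open>A shortest reduced closed walk \<open>w\<close> of collapsed edges would cross its first edge only once.
  The homomorphism to the group of order two that counts the crossings of this edge modulo 2 would
  then be non-trivial on a conjugate of \<open>w\<close>, which lies in the kernel of the surjection
  \<open>\<phi>\<inverse> \<circ> erase_word H\<close> from \<open>H\<close> to \<open>H\<close>.\<close>

lemma no_collapsed_cycle:
  assumes \<phi>: "\<phi> \<in> hom free_group free_group" "inj_on \<phi> (carrier free_group)" "\<phi> ` H = K"
    and gen: "finite B" "H = generate free_group B"
    and loop: "V \<in> verts (core H)" "reduced w" "stays collapsed V w" "walk V w = V"
  shows "w = []"
proof (rule ccontr)
  assume "w \<noteq> []"
  \<comment> \<open>The minimum is taken over all base points, because a shorter loop found inside
    the walk may start at another vertex.\<close>
  define loops where "loops = {(V, w). V \<in> verts (core H) \<and> reduced w \<and> stays collapsed V w \<and>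
    walk V w = V \<and> w \<noteq> []}"
  have "(V, w) \<in> loops" using loop \<open>w \<noteq> []\<close> unfolding loops_def by blast
  then obtain l where l: "l \<in> loops" "\<And>l'. l' \<in> loops \<Longrightarrow> length (snd l) \<le> length (snd l')"
    using ex_has_least_nat[of "\<lambda>l. l \<in> loops" "(V, w)" "length \<circ> snd"] by auto
  obtain V w' where "l = (V, w')" by (cases l)
  moreover from this have "w' \<noteq> []" using l(1) unfolding loops_def by simp
  ultimately obtain y u where yu: "l = (V, y # u)" by (cases w') auto
  have V: "V \<in> verts (core H)" "reduced (y # u)" "stays collapsed V (y # u)" "walk V (y # u) = V"
    using l(1) yu unfolding loops_def by auto
  have min: "length (y # u) \<le> length w'"
    if "V' \<in> verts (core H)" "reduced w'" "stays collapsed V' w'" "walk V' w' = V'" "w' \<noteq> []" for V' w'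
    using l(2)[of "(V', w')"] that yu unfolding loops_def by simp
  note sub = vert_subset[OF V(1)] and subH = subgroup_subset_reduced[OF H]
  define Q where "Q = integer_mod_group 2"
  \<comment> \<open>In the group of order two, 1 is its own inverse, so both orientations of the
    chosen edge may carry it.\<close>
  define c where "c U z = (if (U, z) = (V, y) \<or> (U, z) = (move V y, inv_letter y) then 1 else 0 :: int)" for U z
  interpret Q: group Q unfolding Q_def by simp
  interpret c: coset_labelling Q c
  proof
    fix U :: "'x word set" and z assume U: "U \<subseteq> Collect reduced"
    show "c U z \<in> carrier Q" by (simp add: c_def Q_def carrier_integer_mod_group)
    have "(move U z, inv_letter z) = (V, y) \<longleftrightarrow> (U, z) = (move V y, inv_letter y)"
      using move_inv[OF U, of z] move_inv[OF sub, of y] inv_letter_invol by (metis prod.inject)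
    moreover have "(move U z, inv_letter z) = (move V y, inv_letter y) \<longleftrightarrow> (U, z) = (V, y)"
      using move_inv[OF U, of z] move_inv[OF sub, of y] inv_letter_invol by (metis prod.inject)
    ultimately have "c (move U z) (inv_letter z) = c U z" unfolding c_def by presburger
    then show "c (move U z) (inv_letter z) = inv\<^bsub>Q\<^esub> c U z"
      by (simp add: c_def Q_def carrier_integer_mod_group)
  qed
  \<comment> \<open>Crossing the edge again in the same direction would make \<open>y # a\<close> a
    shorter loop; crossing it backwards would make \<open>a\<close> one, and \<open>a\<close> is not
    empty because \<open>y # u\<close> is reduced.\<close>
  have "stays (\<lambda>U z. c U z = \<one>\<^bsub>Q\<^esub>) (move V y) u"
  proof (rule stays_if_factors)
    fix a z b assume u: "u = a @ z # b"
    have red: "reduced (y # a)" "reduced a"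
      using V(2) u by (auto simp: reduced_Cons reduced_append)
    have st: "stays collapsed V (y # a)" using V(3) u by simp
    have "(walk (move V y) a, z) \<noteq> (V, y)"
      using min[OF V(1) red(1) st] u by auto
    moreover have "(walk (move V y) a, z) \<noteq> (move V y, inv_letter y)"
    proof
      assume eq: "(walk (move V y) a, z) = (move V y, inv_letter y)"
      then have "a \<noteq> []" using V(2) u by (auto simp: reduced_Cons)
      moreover have "move V y \<in> verts (core H)"
        using core_step_verts(2)[OF collapsed_core_step[OF sub]] V(3) by simp
      ultimately show False using min[of "move V y" a] red(2) st eq u by simp
    qed
    ultimately show "c (walk (move V y) a) z = \<one>\<^bsub>Q\<^esub>" unfolding c_def Q_def by auto
  qed
  then have "coset_eval Q c (move V y) u = \<one>\<^bsub>Q\<^esub>" by (rule c.eval_trivial)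
  then have count: "coset_eval Q c V (y # u) = 1" by (simp add: c_def Q_def)
  obtain p where p: "walk H p = V" using vert_word[OF V(1)] .
  \<comment> \<open>Conjugating by a walk from the root to \<open>V\<close> turns the loop into an
    element of \<open>H\<close>.\<close>
  define g where "g = reduce (p @ (y # u) @ inv_word p)"
  have "walk H (p @ (y # u) @ inv_word p) = H"
    using walk_inv_word[OF subH, of p] p V(4) by simp
  then have g: "g \<in> H" unfolding g_def using walk_subgroup_eq_iff[OF H] by blast
  note conj = coset_labelling.eval_conjugate[OF _ subH, of _ _ p "y # u", unfolded p, OF _ V(4)]
  interpret F: group free_group by (rule group_free_group)
  have "erase_word H p \<in> carrier free_group" by (rule erase.eval_closed[OF subH])
  then have erase_g: "erase_word H g = []"
    using conj[OF erase.coset_labelling_axioms] erase_word_collapsed[OF V(3)]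
      erase.eval_reduce[OF subH] unfolding g_def
    by (simp add: reduce_inv_right del: coset_eval.simps append_Cons)
  let ?G = "free_group\<lparr>carrier := H\<rparr>" and ?L = "free_group\<lparr>carrier := K\<rparr>"
  have G: "group ?G" and L: "group ?L"
    using subgroup.subgroup_is_group[OF _ group_free_group] H K by blast+
  have "\<phi> \<in> iso ?G ?L"
    using \<phi> subH unfolding iso_def hom_def bij_betw_def by (auto intro: inj_on_subset)
  then have inv: "inv_into H \<phi> \<in> iso ?L ?G" using group.iso_set_sym[OF G] by fastforce
  have erase: "erase_word H \<in> hom ?G ?L"
    using erase.eval_hom[OF H] erase_word_in unfolding hom_def by auto
  have \<theta>: "inv_into H \<phi> \<circ> erase_word H \<in> hom ?G ?G"
    using hom_compose[OF erase] inv unfolding iso_def by blast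
  have "(inv_into H \<phi> \<circ> erase_word H) ` H = H"
    using erase_word_surj inv unfolding iso_def bij_betw_def image_comp[symmetric] by simp
  moreover have "(inv_into H \<phi> \<circ> erase_word H) g = \<one>\<^bsub>?G\<^esub>"
    using hom_one[of "inv_into H \<phi>" ?L ?G] inv G L erase_g unfolding iso_def by simp
  moreover have "B \<subseteq> generate free_group B" by (blast intro: generate.incl)
  then have "B \<subseteq> H" by (simp only: gen(2)[symmetric])
  moreover have "generate ?G B = H"
    unfolding F.generate_consistent[OF \<open>B \<subseteq> H\<close> H] by (rule gen(2)[symmetric])
  ultimately have "coset_eval Q c H g = \<one>\<^bsub>Q\<^esub>"
    using hom_finite_trivial_on_kernel[OF G gen(1) _ _ Q.is_group _ c.eval_hom[OF H] \<theta>, of g] g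
    by (simp add: Q_def carrier_integer_mod_group)
  \<comment> \<open>What \<open>p\<close> contributes is undone on the way back, so \<open>g\<close>
    has the value 1, against the value 0 just obtained.\<close>
  moreover have "coset_eval Q c H p \<in> {0, 1}"
    using c.eval_closed[OF subH, of p] by (auto simp: Q_def carrier_integer_mod_group)
  ultimately show False
    using conj[OF c.coset_labelling_axioms] count c.eval_reduce[OF subH] unfolding g_def by (auto simp: Q_def carrier_integer_mod_group)
qed

section \<open>The contracted automaton\<close>

text \<open>The reverse of the incoming edge is not collapsed while the first step of
  \<open>w\<close> is, so \<open>w\<close> cannot begin by undoing \<open>y\<close>.\<close>

lemma reach_by_collapsed:
  assumes "core_step H V (inv_letter y)" "\<not> collapsed V (inv_letter y)" "reduced w" "stays collapsed V w"
  shows "reduced (y # w)" "core_step H (walk V w) (inv_letter (last (y # w)))"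
    "w \<noteq> [] \<Longrightarrow> collapsed (walk V w) (inv_letter (last w))"
proof -
  note sub = core_step_subset[OF assms(1)]
  show "reduced (y # w)" using assms by (cases w) (auto simp: reduced_Cons)
  show coll: "collapsed (walk V w) (inv_letter (last w))" if nonempty: "w \<noteq> []"
  proof -
    obtain a l where w: "w = a @ [l]" using nonempty by (cases w rule: rev_cases) auto
    then have "collapsed (walk V a) l" using assms(4) by simp
    then show ?thesis using collapsed_inv_iff[OF walk_subset[OF sub], of a l] unfolding w by simp
  qed
  show "core_step H (walk V w) (inv_letter (last (y # w)))"
  proof (cases "w = []")
    case False
    then show ?thesis using collapsed_core_step[OF walk_subset[OF sub] coll] by simp
  qed (simp add: assms(1))
qed

text \<open>A state is an edge into \<open>V\<close>, so \<open>collapsed\<close> is tested on the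
  reversed edge, which starts at \<open>V\<close>.\<close>

definition collapsed_states :: "('x word set \<times> 'x letter) set" where
  "collapsed_states = {(V, y) \<in> B_states H. collapsed V (inv_letter y)}"

abbreviation "passing \<equiv> passes (B_automaton H) collapsed_states"

lemma in_collapsed_states_iff:
  "(V, y) \<in> collapsed_states \<longleftrightarrow> core_step H V (inv_letter y) \<and> collapsed V (inv_letter y)"
  by (simp add: collapsed_states_def B_states_iff[OF H])

lemma move_in_collapsed_states_iff:
  assumes "core_step H V z"
  shows "(move V z, z) \<in> collapsed_states \<longleftrightarrow> collapsed V z"
  using collapsed_inv_iff[OF core_step_subset[OF assms]] core_step_inv[OF H assms]
  by (simp add: in_collapsed_states_iff)

lemma passing_iff:
  "((V, y), (W, z)) \<in> passing \<longleftrightarrow>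
     core_step H V (inv_letter y) \<and> core_step H V z \<and> z \<noteq> inv_letter y \<and> collapsed V z \<and> W = move V z"
  using move_in_collapsed_states_iff[of V z]
  by (auto simp: passes_def B_transitions_iff[OF H])

text \<open>The counterpart of \<open>is_path_B_automaton\<close> for chains through removed states:
  they are the reduced walks along collapsed edges that do not undo \<open>y\<close>.\<close>

lemma passing_rtrancl_iff:
  assumes "core_step H V (inv_letter y)"
  shows "((V, y), r) \<in> passing\<^sup>* \<longleftrightarrow>
    (\<exists>w. reduced (y # w) \<and> stays collapsed V w \<and> r = (walk V w, last (y # w)))"
proof
  assume "((V, y), r) \<in> passing\<^sup>*"
  then show "\<exists>w. reduced (y # w) \<and> stays collapsed V w \<and> r = (walk V w, last (y # w))"
  proof (induction rule: rtrancl_induct)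
    case base
    show ?case by (rule exI[of _ "[]"]) simp
  next
    case (step q r)
    then obtain w where w: "reduced (y # w)" "stays collapsed V w" "q = (walk V w, last (y # w))"
      by blast
    obtain W z where r: "r = (W, z)" by (cases r)
    have "z \<noteq> inv_letter (last (y # w))" "collapsed (walk V w) z" "W = move (walk V w) z"
      using step.hyps(2) unfolding r w(3) passing_iff by blast+
    then have "reduced ((y # w) @ [z]) \<and> stays collapsed V (w @ [z]) \<and>
      r = (walk V (w @ [z]), last (y # w @ [z]))"
      using w(1,2) r unfolding reduced_append by simp
    then show ?case by (intro exI[of _ "w @ [z]"]) simp
  qed
next
  assume "\<exists>w. reduced (y # w) \<and> stays collapsed V w \<and> r = (walk V w, last (y # w))"
  then obtain w where "reduced (y # w)" "stays collapsed V w" "r = (walk V w, last (y # w))" by blast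
  then show "((V, y), r) \<in> passing\<^sup>*"
    using assms
  proof (induction w arbitrary: V y)
    case (Cons z w)
    have z: "collapsed V z" "core_step H V z"
      using Cons.prems(2) collapsed_core_step[OF core_step_subset[OF Cons.prems(4)]] by simp_all
    have "((V, y), (move V z, z)) \<in> passing"
      using Cons.prems z by (simp add: passing_iff reduced_Cons)
    moreover have "((move V z, z), r) \<in> passing\<^sup>*"
      using Cons.prems core_step_inv[OF H z(2)] by (intro Cons.IH) (simp_all add: reduced_Cons)
    ultimately show ?case by (rule converse_rtrancl_into_rtrancl)
  qed simp
qed

abbreviation "contracted \<equiv> contract collapsed_states (B_automaton H)"

abbreviation "map_state \<equiv> \<lambda>(V, y). (f V, y)"

lemma states_contracted_iff:
  "(V, y) \<in> states contracted \<longleftrightarrow> core_step H V (inv_letter y) \<and> \<not> collapsed V (inv_letter y)"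
  by (auto simp: contract_def B_simps[OF H] B_states_iff[OF H] in_collapsed_states_iff)

lemma bij_betw_states_contracted: "bij_betw map_state (states contracted) (B_states K)"
  unfolding bij_betw_def
proof
  show "inj_on map_state (states contracted)"
  proof (rule inj_onI)
    fix p q assume pq: "p \<in> states contracted" "q \<in> states contracted" "map_state p = map_state q"
    obtain V y where p: "p = (V, y)" by (cases p)
    moreover from this have q: "q = (fst q, y)" using pq(3) by (cases q) simp
    ultimately show "p = q"
      using dart_inj[of V "inv_letter y" "fst q"] states_contracted_iff pq
      by (metis case_prod_conv prod.inject)
  qed
  have "(W, y) \<in> map_state ` states contracted \<longleftrightarrow> (W, y) \<in> B_states K" for W y
  proof
    assume "(W, y) \<in> map_state ` states contracted"
    then obtain V where "(V, y) \<in> states contracted" "W = f V" by (auto simp: image_iff)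
    then show "(W, y) \<in> B_states K"
      using states_contracted_iff[of V y] dart_map(1)[of V "inv_letter y"] B_states_iff[OF K] by blast
  next
    assume "(W, y) \<in> B_states K"
    then have "core_step K W (inv_letter y)" using B_states_iff[OF K] by blast
    then obtain V where "core_step H V (inv_letter y)" "\<not> collapsed V (inv_letter y)" "f V = W"
      by (rule dart_surj)
    then have "(V, y) \<in> states contracted" "(W, y) = map_state (V, y)"
      using states_contracted_iff[of V y] by simp_all
    then show "(W, y) \<in> map_state ` states contracted" by (rule rev_image_eqI)
  qed
  then show "map_state ` states contracted = B_states K"
    unfolding set_eq_iff split_paired_All by blast
qed

text \<open>Being outside \<open>collapsed_states\<close> does not make \<open>(V, y)\<close> a
  state. That follows from the first move of the chain or, if the chain is empty, from its
  end.\<close>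

lemma passing_source:
  assumes "(V, y) \<notin> collapsed_states" "((V, y), q) \<in> passing\<^sup>*" "q \<in> B_states H"
  shows "core_step H V (inv_letter y)" "\<not> collapsed V (inv_letter y)"
proof -
  show "core_step H V (inv_letter y)"
    using assms(2)
  proof (cases rule: converse_rtranclE)
    case base
    then show ?thesis using assms(3) B_states_iff[OF H] by blast
  next
    case (step r)
    then show ?thesis by (cases r) (simp add: passing_iff)
  qed
  then show "\<not> collapsed V (inv_letter y)" using assms(1) in_collapsed_states_iff by blast
qed

text \<open>Fibres of \<open>f\<close> are connected by collapsed walks. The letter on arrival at
  \<open>V'\<close> is \<open>y\<close> or has a collapsed reverse, so a surviving edge leaving
  \<open>V'\<close> can be blocked only if its label is the inverse of \<open>y\<close>.\<close>

lemma passing_link: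
  assumes V: "core_step H V (inv_letter y)" "\<not> collapsed V (inv_letter y)"
    and V': "V' \<in> verts (core H)" "f V = f V'"
  obtains w where "((V, y), (V', last (y # w))) \<in> passing\<^sup>*"
    "core_step H V' (inv_letter (last (y # w)))"
    "w \<noteq> [] \<Longrightarrow> collapsed V' (inv_letter (last w))"
proof -
  obtain w where w: "reduced w" "stays collapsed V w" "walk V w = V'"
    using collapsed_connected[OF core_step_verts(1)[OF V(1)] V'] .
  then show thesis
    using that[of w] reach_by_collapsed[OF V w(1,2)] passing_rtrancl_iff[OF V(1)] by blast
qed

text \<open>The forest property enters here: a non-trivial reduced loop of collapsed edges would
  allow a walk to return and leave against its incoming edge.\<close>

lemma transitions_contracted_subset:
  assumes acyclic: "\<And>V w. V \<in> verts (core H) \<Longrightarrow> reduced w \<Longrightarrow> stays collapsed V w \<Longrightarrow>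
      walk V w = V \<Longrightarrow> w = []"
    and t: "((V, y), z, (W, z')) \<in> transitions contracted"
  shows "((f V, y), z, (f W, z')) \<in> transitions (B_automaton K)"
proof -
  have out: "(V, y) \<notin> collapsed_states" "(W, z') \<notin> collapsed_states"
    using t by (simp_all add: contract_def)
  have "\<exists>q. ((V, y), q) \<in> passing\<^sup>* \<and> (q, z, (W, z')) \<in> transitions (B_automaton H)"
    using t by (simp add: contract_def)
  then obtain V' y' where q: "((V, y), (V', y')) \<in> passing\<^sup>*"
    "((V', y'), z, (W, z')) \<in> transitions (B_automaton H)"
    by (metis surj_pair)
  note q' = q(2)[unfolded B_transitions_iff[OF H]]
  then have "(V', y') \<in> B_states H" using B_states_iff[OF H] by blast
  note V = passing_source[OF out(1) q(1) this]
  have V': "core_step H V' z" "\<not> collapsed V' z"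
    using q' out(2) move_in_collapsed_states_iff[of V' z] by blast+
  obtain w where w: "reduced (y # w)" "stays collapsed V w" "V' = walk V w" "y' = last (y # w)"
    using q(1) passing_rtrancl_iff[OF V(1)] by blast
  have fV: "f V' = f V" using stays_collapsed_f[OF core_step_subset[OF V(1)] w(2)] w(3) by simp
  \<comment> \<open>If equal, \<open>z\<close> at \<open>V'\<close> and the reverse of
    \<open>y\<close> at \<open>V\<close> are surviving darts with the same image, so
    \<open>V' = V\<close> and \<open>w\<close> is a loop. It is empty by \<open>acyclic\<close>, and
    the transition would backtrack.\<close>
  have "z \<noteq> inv_letter y"
  proof
    assume z: "z = inv_letter y"
    then have "V' = V" using dart_inj[OF _ _ V] V' fV by blast
    then have "w = []"
      using acyclic[OF core_step_verts(1)[OF V(1)] _ w(2)] w(1,3) by (simp add: reduced_Cons)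
    then show False using q' w(4) z by simp
  qed
  moreover have "core_step K (f V) z" "move (f V) z = f (move V' z)"
    using dart_map[OF V'] unfolding fV by blast+
  ultimately show ?thesis
    using dart_map(1)[OF V] q' unfolding B_transitions_iff[OF K] by metis
qed

lemma transitions_subset_contracted:
  assumes t: "((V0, y), z, (W0, z')) \<in> transitions (B_automaton K)"
  shows "\<exists>V W. f V = V0 \<and> f W = W0 \<and> ((V, y), z, (W, z')) \<in> transitions contracted"
proof -
  have t: "core_step K V0 (inv_letter y)" "core_step K V0 z" "z \<noteq> inv_letter y" "W0 = move V0 z" "z' = z"
    using t unfolding B_transitions_iff[OF K] by blast+
  obtain V where V: "core_step H V (inv_letter y)" "\<not> collapsed V (inv_letter y)" "f V = V0"
    using dart_surj[OF t(1)] .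
  obtain V' where V': "core_step H V' z" "\<not> collapsed V' z" "f V' = V0"
    using dart_surj[OF t(2)] .
  have "f V = f V'" using V(3) V'(3) by simp
  then obtain w where w: "((V, y), (V', last (y # w))) \<in> passing\<^sup>*"
    "core_step H V' (inv_letter (last (y # w)))" "w \<noteq> [] \<Longrightarrow> collapsed V' (inv_letter (last w))"
    using passing_link[OF V(1,2) core_step_verts(1)[OF V'(1)]] by blast
  \<comment> \<open>For empty \<open>w\<close> this is the condition on \<open>z\<close> in the
    automaton of \<open>K\<close>; otherwise the reverse of the last letter is collapsed at
    \<open>V'\<close> and \<open>z\<close> is not.\<close>
  have "z \<noteq> inv_letter (last (y # w))"
    using w(3) V'(2) t(3) by (cases "w = []") auto
  then have "((V', last (y # w)), z, (move V' z, z)) \<in> transitions (B_automaton H)"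
    using w(2) V'(1) unfolding B_transitions_iff[OF H] by blast
  moreover have "(V, y) \<notin> collapsed_states" using V(2) in_collapsed_states_iff by blast
  moreover have "(move V' z, z) \<notin> collapsed_states"
    using V' move_in_collapsed_states_iff by blast
  ultimately have "((V, y), z, (move V' z, z)) \<in> transitions contracted"
    using w(1) unfolding contract_def by (simp only: automaton.simps mem_Collect_eq case_prod_conv) blast
  moreover have "f (move V' z) = W0" using dart_map(2)[OF V'(1,2)] V'(3) t(4) by simp
  ultimately show ?thesis using V(3) t(5) by blast
qed

text \<open>A surviving state inherits the role of an end state when a collapsed walk leads from its
  vertex to \<open>H\<close>, that is, when its vertex lies in the fibre of
  \<open>K\<close>.\<close>

lemma ends_contracted:
  "map_state ` {p. p \<notin> collapsed_states \<and> (\<exists>q\<in>{(v, y) \<in> B_states H. v = H}. (p, q) \<in> passing\<^sup>*)} =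
   {(v, y) \<in> B_states K. v = K}" (is "map_state ` ?I = ?J")
proof
  show "map_state ` ?I \<subseteq> ?J"
  proof
    fix s assume "s \<in> map_state ` ?I"
    then obtain p where p: "p \<in> ?I" "s = map_state p" by blast
    obtain V y where Vy: "p = (V, y)" by (cases p)
    then obtain q where q: "(V, y) \<notin> collapsed_states" "q \<in> B_states H" "fst q = H" "((V, y), q) \<in> passing\<^sup>*"
      using p(1) by auto
    note V = passing_source[OF q(1,4,2)]
    obtain w where "stays collapsed V w" "H = walk V w"
      using q(3,4) passing_rtrancl_iff[OF V(1), of q] by auto
    then have "f V = K" using stays_collapsed_f[OF core_step_subset[OF V(1)]] f_root by metis
    then show "s \<in> ?J" using dart_map(1)[OF V] p(2) by (simp add: B_states_iff[OF K] Vy)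
  qed
  show "?J \<subseteq> map_state ` ?I"
  proof
    fix s assume "s \<in> ?J"
    then obtain y where s: "s = (K, y)" "(K, y) \<in> B_states K" by blast
    then have "core_step K K (inv_letter y)" using B_states_iff[OF K] by blast
    then obtain V where V: "core_step H V (inv_letter y)" "\<not> collapsed V (inv_letter y)" "f V = K"
      by (rule dart_surj)
    have "f V = f H" using V(3) f_root by simp
    then obtain w where "((V, y), (H, last (y # w))) \<in> passing\<^sup>*"
      "core_step H H (inv_letter (last (y # w)))"
      using passing_link[OF V(1,2) root_vert] by blast
    then have "(V, y) \<in> ?I" using V(2) in_collapsed_states_iff B_states_iff[OF H] by blast
    moreover have "s = map_state (V, y)" using V(3) s by simp
    ultimately show "s \<in> map_state ` ?I" by (rule rev_image_eqI)
  qed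
qed

lemma automaton_collapse_B_automaton:
  assumes fin: "finite (verts (core H))" "finite (UNIV :: 'x set)"
    and acyclic: "\<And>V w. V \<in> verts (core H) \<Longrightarrow> reduced w \<Longrightarrow> stays collapsed V w \<Longrightarrow>
      walk V w = V \<Longrightarrow> w = []"
  shows "automaton_collapse (B_automaton H) (B_automaton K)"
proof -
  have "B_states H \<subseteq> verts (core H) \<times> UNIV" by (auto simp: B_states_def)
  moreover have "finite (verts (core H) \<times> (UNIV :: 'x letter set))"
    using fin by (simp add: finite_prod)
  ultimately have "finite collapsed_states"
    unfolding collapsed_states_def by (elim finite_subset[rotated]) blast
  moreover have "collapsed_states \<subseteq> states (B_automaton H)"
    by (auto simp: collapsed_states_def B_simps[OF H])
  \<comment> \<open>A cycle of collapsed states would spell a non-empty reduced closed walk of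
    collapsed edges.\<close>
  moreover have "(d, d) \<notin> passing\<^sup>+" if "d \<in> collapsed_states" for d
  proof
    assume "(d, d) \<in> passing\<^sup>+"
    then obtain e where e: "(d, e) \<in> passing" "(e, d) \<in> passing\<^sup>*" by (meson tranclD)
    obtain V y where d: "d = (V, y)" by (cases d)
    obtain W z where "e = (W, z)" by (cases e)
    with e(1) have Vz: "core_step H V z" "collapsed V z" "e = (move V z, z)"
      unfolding d by (simp_all add: passing_iff)
    obtain w where w: "reduced (z # w)" "stays collapsed (move V z) w" "V = walk (move V z) w"
      using e(2) passing_rtrancl_iff[of "move V z" z] core_step_inv[OF H Vz(1)] unfolding Vz(3) d by blast
    have "z # w = []"
      by (rule acyclic[OF core_step_verts(1)[OF Vz(1)] w(1)]) (use Vz(2) w(2,3) in simp_all)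
    then show False by simp
  qed
  ultimately have "collapse_step\<^sup>*\<^sup>* (B_automaton H) contracted" by (rule collapse_steps_contract)
  moreover have "automaton_iso contracted (B_automaton K)"
  proof -
    have "(\<lambda>(p, z, q). (map_state p, z, map_state q)) ` transitions contracted = transitions (B_automaton K)"
      (is "?g ` _ = _")
    proof
      show "?g ` transitions contracted \<subseteq> transitions (B_automaton K)"
        using transitions_contracted_subset[OF acyclic] by auto
      show "transitions (B_automaton K) \<subseteq> ?g ` transitions contracted"
      proof
        fix t assume t: "t \<in> transitions (B_automaton K)"
        obtain V0 y z W0 z' where eq: "t = ((V0, y), z, (W0, z'))" by (metis surj_pair)
        then obtain V W where "f V = V0" "f W = W0" "((V, y), z, (W, z')) \<in> transitions contracted"
          using transitions_subset_contracted t by blast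
        moreover from this have "t = ?g ((V, y), z, (W, z'))" using eq by simp
        ultimately show "t \<in> ?g ` transitions contracted" by (intro rev_image_eqI)
      qed
    qed
    moreover have "map_state ` initials contracted = initials (B_automaton K)"
      "map_state ` finals contracted = finals (B_automaton K)"
      using ends_contracted by (simp_all add: contract_def B_simps[OF H] B_simps[OF K])
    ultimately show ?thesis
      unfolding automaton_iso_def B_simps[OF K] using bij_betw_states_contracted by blast
  qed
  ultimately show ?thesis unfolding automaton_collapse_def by blast
qed

end

section \<open>The collapse induced by a Whitehead automorphism\<close>

theorem theorem3:
  fixes H :: "'x::finite word set" and \<phi> :: "'x word \<Rightarrow> 'x word"
  assumes rank: "CARD('x) > 2"
    and factor: "free_factor free_group H"
    and noncyclic: "\<not> cyclic_group (subgroup_generated free_group H)"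
    and generators: "\<exists>S. finite S \<and> (\<forall>w\<in>S. cyclically_reduced w) \<and> H = generate free_group S"
    and core_gt: "card (verts (core H)) > 1"
    and whitehead: "whitehead_automorphism \<phi>"
    and fewer_verts: "card (verts (core (\<phi> ` H))) < card (verts (core H))"
    and fewer_edges: "card (edges (core (\<phi> ` H))) < card (edges (core H))"
    and collapse: "graph_collapse (core H) (core (\<phi> ` H))"
  shows "ergodic (B_automaton (\<phi> ` H)) \<and>
         accepted_words (B_automaton (\<phi> ` H)) = reduced_language (\<phi> ` H) \<and>
         automaton_collapse (B_automaton H) (B_automaton (\<phi> ` H))"
proof -
  interpret F: group free_group by (rule group_free_group)
  obtain B where B: "finite B" "\<And>w. w \<in> B \<Longrightarrow> cyclically_reduced w" "H = generate free_group B"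
    using generators by blast
  have "B \<subseteq> carrier free_group" using B(2) by (auto simp: cyclically_reduced_def)
  then have H: "subgroup H free_group" unfolding B(3) by (rule F.generate_is_subgroup)
  note \<phi> = whitehead_automorphism_inj[OF whitehead]
  have hom: "group_hom free_group free_group \<phi>"
    using \<phi>(1) by (simp add: group_hom_def group_hom_axioms_def F.is_group)
  have K: "subgroup (\<phi> ` H) free_group" using group_hom.subgroup_img_is_subgroup[OF hom H] .
  \<comment> \<open>\<open>subgroup_generated\<close> intersects its generators with the carrier;
    for \<open>{g}\<close> and for \<open>H\<close> the resulting group is the same restriction of
    the free group to \<open>H\<close>.\<close>
  have noncyc: "H \<noteq> generate free_group {g}" if "g \<in> H" for g
  proof
    assume eq: "H = generate free_group {g}"
    have "carrier free_group \<inter> {g} = {g}" using subgroup_free_groupD(2)[OF H that] by simp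
    then have "subgroup_generated free_group {g} = free_group\<lparr>carrier := H\<rparr>"
      using eq by (simp add: subgroup_generated_def)
    also have "\<dots> = subgroup_generated free_group H"
      using subgroup.carrier_subgroup_generated_subgroup[OF H] by (simp add: subgroup_generated_def)
    finally show False using noncyclic F.cyclic_group_generated[of g] by simp
  qed
  \<comment> \<open>A non-empty generator exists because \<open>H\<close> is not cyclic. As it is
    cyclically reduced, its first letter and the inverse of its last are different heads.\<close>
  have two: "\<exists>l\<in>heads H. \<exists>l'\<in>heads H. l \<noteq> l'"
  proof -
    have "\<not> B \<subseteq> {[]}"
    proof
      assume "B \<subseteq> {[]}"
      then have "H \<subseteq> generate free_group {[]}" unfolding B(3) by (rule F.mono_generate)
      moreover have "generate free_group {[]} \<subseteq> H"
        using subgroup_free_groupD(1)[OF H] by (intro F.generate_subgroup_incl[OF _ H]) simp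
      ultimately show False using noncyc[OF subgroup_free_groupD(1)[OF H]] by blast
    qed
    then obtain w where w: "w \<in> B" "w \<noteq> []" by blast
    then have "w \<in> H" unfolding B(3) by (simp add: generate.incl)
    then have "hd w \<in> heads H" "inv_letter (last w) \<in> heads H"
      using w(2) hd_in_heads[OF H] inv_last_in_heads[OF H] by blast+
    moreover have "hd w \<noteq> inv_letter (last w)"
      using B(2)[OF w(1)] w(2) inv_letter_invol[of "last w"] by (auto simp: cyclically_reduced_def)
    ultimately show ?thesis by blast
  qed
  obtain S f where "core_contraction H (\<phi> ` H) S f"
  proof -
    have root: "root (core L) = L" for L :: "'x word set" by (simp add: core_def)
    obtain S f where "S \<subseteq> edges (core H)" "f ` verts (core H) = verts (core (\<phi> ` H))" "f H = \<phi> ` H"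
      "\<forall>u\<in>verts (core H). \<forall>v\<in>verts (core H). f u = f v \<longleftrightarrow>
        (u, v) \<in> ({(u, v). \<exists>x. (u, x, v) \<in> S} \<union> {(u, v). \<exists>x. (u, x, v) \<in> S}\<inverse>)\<^sup>*"
      "bij_betw (\<lambda>(u, x, v). (f u, x, f v)) (edges (core H) - S) (edges (core (\<phi> ` H)))"
      using collapse unfolding graph_collapse_def Let_def root by blast
    then have "core_contraction H (\<phi> ` H) S f"
      using H K unfolding core_contraction_def by blast
    then show thesis by (rule that)
  qed
  then interpret core_contraction H "\<phi> ` H" S f .
  \<comment> \<open>\<open>card\<close> is 0 on infinite sets, so \<open>core_gt\<close> implies
    finiteness.\<close>
  have "finite (verts (core H))" using core_gt card.infinite by fastforce
  then have coll: "automaton_collapse (B_automaton H) (B_automaton (\<phi> ` H))"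
    using no_collapsed_cycle[OF \<phi> refl B(1,3)] by (intro automaton_collapse_B_automaton) simp_all
  have erg: "ergodic (B_automaton (\<phi> ` H))"
    using ergodic_automaton_collapse[OF ergodic_B_automaton[OF H noncyc two] coll] .
  \<comment> \<open>The trivial subgroup has no heads, so \<open>two_heads_if_ergodic\<close> asks
    for a non-trivial image; injectivity of \<open>\<phi>\<close> provides it.\<close>
  have "\<phi> ` H \<noteq> {[]}"
  proof
    assume trivial: "\<phi> ` H = {[]}"
    have "h = []" if "h \<in> H" for h
    proof -
      have "\<phi> h = []" using that trivial by blast
      moreover have "\<phi> [] = []" using subgroup_free_groupD(1)[OF H] trivial by blast
      ultimately show ?thesis
        using inj_onD[OF \<phi>(2), of h "[]"] subgroup_free_groupD(2)[OF H that] by simp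
    qed
    then show False using two heads_iff[OF H] by blast
  qed
  then show ?thesis
    using erg coll accepted_words_B_automaton[OF K two_heads_if_ergodic[OF K erg]] by blast
qed

end
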